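(* Let $\{\varrho(\alpha,\bar\alpha):\alpha\in\mathcal O\}$, $\mathcal O\subset\mathbb C^n$ a domain, be a smooth family of density operators on a Hilbert space $\mathcal H$ having right logarithmic derivatives $\hat h_1,\dots,\hat h_n$, $\varrho\,\hat h_k=\partial\varrho/\partial\bar\alpha^k$, and let $\mathsf H(\alpha,\bar\alpha)=[H_{kl}]$, $H_{kl}=\mathrm{Tr}[\hat h_k\hat h_l^*\varrho]$, be nondegenerate. Let $\vartheta_1,\dots,\vartheta_m$ be complex-valued functions $\vartheta_i(\alpha,\bar\alpha)$ on $\mathcal O$, differentiable independently in $\alpha$ and $\bar\alpha$, and let $\Pi(\mathrm d\lambda)$ be any quantum probability measure whose complex results $\lambda=(\lambda_1,\dots,\lambda_m)$ are unbiased estimates of the $\vartheta_i$, i.e. $\int\lambda_i\,\mathrm{Tr}[\Pi(\mathrm d\lambda)\varrho(\alpha,\bar\alpha)]=\vartheta_i(\alpha,\bar\alpha)$ for all $\alpha\in\mathcal O$. Then the covariance matrix $\mathsf R=[R_{ij}]$, $$R_{ij}(\alpha,\bar\alpha)=\int(\lambda_i-\vartheta_i)(\bar\lambda_j-\bar\vartheta_j)\,\mathrm{Tr}[\Pi(\mathrm d\lambda)\varrho(\alpha,\bar\alpha)],$$ satisfies, for every $\alpha\in\mathcal O$, $$\mathsf R(\alpha,\bar\alpha)\ \ge\ \mathsf D(\alpha,\bar\alpha)\,\mathsf H(\alpha,\bar\alpha)^{-1}\,\mathsf D(\alpha,\bar\alpha)^\dagger ,$$ where $\mathsf D=[\partial\vartheta_i/\partial\alpha^k]$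 is the $m\times n$ matrix of derivatives and $\mathsf D^\dagger$ is its Hermitian adjoint.
   Context: A quantum probability measure (QPM) on a measurable space $X$ is a positive-operator-valued measure $\Pi$ on $\mathcal H$ with $\int\Pi(\mathrm d\varkappa)=\hat 1$ (not necessarily projection-valued). In the state with density operator $\varrho$ the outcome distribution is $\Pr(B)=\mathrm{Tr}\,\varrho\,\Pi(B)$. The derivatives $\partial/\partial\alpha^k$, $\partial/\partial\bar\alpha^k$ are the complex (Wirtinger) derivatives. Taking adjoints, $\hat h_k^*\varrho=\partial\varrho/\partial\alpha^k$. The matrix inequality $A\ge B$ means that $A-B$ is Hermitian and nonnegative definite. Standing regularity assumptions: the family is smooth, the logarithmic derivatives exist as operators in $\mathcal H$, the operators, integrals (in particular the integrals defining $\hat q_i=\int\lambda_i\Pi(\mathrm d\lambda)$) and traces occurring are well defined and finite, and differentiation with respect to the parameters may be interchanged with the trace. *)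

theory Defs
  imports "HOL-Analysis.Analysis"
begin

section \<open>Complex Hilbert spaces\<close>

text \<open>The inner product is conjugate-linear in the first argument.\<close>

class complex_inner = real_normed_vector +
  fixes scaleC :: "complex \<Rightarrow> 'a \<Rightarrow> 'a" (infixr "*\<^sub>C" 75)
    and cinner :: "'a \<Rightarrow> 'a \<Rightarrow> complex"
  assumes scaleC_add_right: "c *\<^sub>C (x + y) = c *\<^sub>C x + c *\<^sub>C y"
    and scaleC_add_left: "(c + d) *\<^sub>C x = c *\<^sub>C x + d *\<^sub>C x"
    and scaleC_scaleC: "c *\<^sub>C d *\<^sub>C x = (c * d) *\<^sub>C x"
    and scaleC_of_real: "complex_of_real r *\<^sub>C x = r *\<^sub>R x"
    and cinner_commute: "cinner x y = cnj (cinner y x)"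
    and cinner_add_right: "cinner x (y + z) = cinner x y + cinner x z"
    and cinner_scaleC_right: "cinner x (c *\<^sub>C y) = c * cinner x y"
    and cinner_self: "cinner x x = complex_of_real ((norm x)\<^sup>2)"

class chilbert_space = complex_inner + complete_space

instantiation complex :: chilbert_space
begin

definition scaleC_complex :: "complex \<Rightarrow> complex \<Rightarrow> complex"
  where "scaleC_complex c x = c * x"

definition cinner_complex :: "complex \<Rightarrow> complex \<Rightarrow> complex"
  where "cinner_complex x y = cnj x * y"

instance
  by standard
    (auto simp: scaleC_complex_def cinner_complex_def algebra_simps scaleR_conv_of_real
      simp del: of_real_power simp flip: complex_norm_square)

end

definition orthonormal_basis :: "'h::chilbert_space set \<Rightarrow> bool"
  where "orthonormal_basis E \<longleftrightarrow>
    (\<forall>e\<in>E. norm e = 1) \<and>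
    (\<forall>e\<in>E. \<forall>f\<in>E. e \<noteq> f \<longrightarrow> cinner e f = 0) \<and>
    (\<forall>\<psi>. (\<forall>e\<in>E. cinner e \<psi> = 0) \<longrightarrow> \<psi> = 0)"

section \<open>Operators and traces\<close>

definition bounded_clinear :: "('h::complex_inner \<Rightarrow> 'h) \<Rightarrow> bool"
  where "bounded_clinear A \<longleftrightarrow> bounded_linear A \<and> (\<forall>c \<psi>. A (c *\<^sub>C \<psi>) = c *\<^sub>C A \<psi>)"

definition positive_op :: "('h::complex_inner \<Rightarrow> 'h) \<Rightarrow> bool"
  where "positive_op A \<longleftrightarrow> bounded_clinear A \<and> (\<forall>\<psi>. cinner \<psi> (A \<psi>) \<in> \<real>\<^sub>\<ge>\<^sub>0)"

text \<open>The trace of an everywhere defined operator is well defined and finite if the sum of its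
  diagonal matrix elements converges (unconditionally) in every orthonormal basis, to a value that
  does not depend on the basis. For bounded operators this means being of trace class.\<close>

definition has_trace :: "('h::chilbert_space \<Rightarrow> 'h) \<Rightarrow> complex \<Rightarrow> bool"
  where "has_trace A t \<longleftrightarrow>
    (\<forall>E. orthonormal_basis E \<longrightarrow> ((\<lambda>e. cinner e (A e)) has_sum t) E)"

definition Tr :: "('h::chilbert_space \<Rightarrow> 'h) \<Rightarrow> complex"
  where "Tr A = (THE t. has_trace A t)"

definition density_operator :: "('h::chilbert_space \<Rightarrow> 'h) \<Rightarrow> bool"
  where "density_operator \<rho> \<longleftrightarrow> positive_op \<rho> \<and> has_trace \<rho> 1"

text \<open>Possibly unbounded operators are partial maps; \<^term>\<open>dom T\<close> is the domain of the operator
  and \<^term>\<open>S \<circ>\<^sub>m T\<close> the operator product with its natural domain.\<close>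

definition densely_defined_op :: "('h::chilbert_space \<rightharpoonup> 'h) \<Rightarrow> bool"
  where "densely_defined_op T \<longleftrightarrow>
    closure (dom T) = UNIV \<and>
    (\<forall>\<phi>\<in>dom T. \<forall>\<psi>\<in>dom T. T (\<phi> + \<psi>) = Some (the (T \<phi>) + the (T \<psi>))) \<and>
    (\<forall>c. \<forall>\<phi>\<in>dom T. T (c *\<^sub>C \<phi>) = Some (c *\<^sub>C the (T \<phi>)))"

definition op_adj :: "('h::chilbert_space \<rightharpoonup> 'h) \<Rightarrow> ('h \<rightharpoonup> 'h)"
  where "op_adj T = (\<lambda>\<psi>.
    if \<exists>\<xi>. \<forall>\<phi>\<in>dom T. cinner \<psi> (the (T \<phi>)) = cinner \<xi> \<phi>
    then Some (THE \<xi>. \<forall>\<phi>\<in>dom T. cinner \<psi> (the (T \<phi>)) = cinner \<xi> \<phi>)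
    else None)"

section \<open>Wirtinger derivatives and logarithmic derivatives\<close>

text \<open>With \<open>\<alpha>\<^sup>k = x + \<i>y\<close>, these are \<open>(\<partial>/\<partial>x - \<i>\<partial>/\<partial>y)/2\<close> and \<open>(\<partial>/\<partial>x + \<i>\<partial>/\<partial>y)/2\<close>.\<close>

definition wirtinger :: "'n::finite \<Rightarrow> (complex^'n \<Rightarrow> 'b::complex_inner) \<Rightarrow> complex^'n \<Rightarrow> 'b"
  where "wirtinger k f \<alpha> = (1/2) *\<^sub>C
    (frechet_derivative f (at \<alpha>) (axis k 1) - \<i> *\<^sub>C frechet_derivative f (at \<alpha>) (axis k \<i>))"

definition wirtinger_bar :: "'n::finite \<Rightarrow> (complex^'n \<Rightarrow> 'b::complex_inner) \<Rightarrow> complex^'n \<Rightarrow> 'b"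
  where "wirtinger_bar k f \<alpha> = (1/2) *\<^sub>C
    (frechet_derivative f (at \<alpha>) (axis k 1) + \<i> *\<^sub>C frechet_derivative f (at \<alpha>) (axis k \<i>))"

text \<open>The operator derivatives are taken in the strong operator topology.\<close>

definition op_wirtinger ::
    "'n::finite \<Rightarrow> (complex^'n \<Rightarrow> 'h::complex_inner \<Rightarrow> 'h) \<Rightarrow> complex^'n \<Rightarrow> 'h \<Rightarrow> 'h"
  where "op_wirtinger k \<rho> \<alpha> = (\<lambda>\<phi>. wirtinger k (\<lambda>\<beta>. \<rho> \<beta> \<phi>) \<alpha>)"

definition op_wirtinger_bar ::
    "'n::finite \<Rightarrow> (complex^'n \<Rightarrow> 'h::complex_inner \<Rightarrow> 'h) \<Rightarrow> complex^'n \<Rightarrow> 'h \<Rightarrow> 'h"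
  where "op_wirtinger_bar k \<rho> \<alpha> = (\<lambda>\<phi>. wirtinger_bar k (\<lambda>\<beta>. \<rho> \<beta> \<phi>) \<alpha>)"

text \<open>As \<open>h\<close> may be unbounded, \<open>\<rho> h = \<partial>\<rho>/\<partial>\<alpha>\<^sup>k\<close> (conjugate derivative) is an identity on the
  domain of \<open>h\<close>.\<close>

definition right_log_derivative ::
    "'n::finite \<Rightarrow> (complex^'n \<Rightarrow> 'h::chilbert_space \<Rightarrow> 'h) \<Rightarrow> complex^'n \<Rightarrow> ('h \<rightharpoonup> 'h) \<Rightarrow> bool"
  where "right_log_derivative k \<rho> \<alpha> h \<longleftrightarrow>
    densely_defined_op h \<and> (\<forall>\<phi>\<in>dom h. \<rho> \<alpha> (the (h \<phi>)) = op_wirtinger_bar k \<rho> \<alpha> \<phi>)"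

text \<open>The operator \<open>h\<^sub>k h\<^sub>l\<^sup>* \<rho>\<close> whose trace is the entry \<open>H\<^sub>k\<^sub>l\<close> of the information matrix.\<close>

definition info_op :: "('h::chilbert_space \<rightharpoonup> 'h) \<Rightarrow> ('h \<rightharpoonup> 'h) \<Rightarrow> ('h \<Rightarrow> 'h) \<Rightarrow> ('h \<rightharpoonup> 'h)"
  where "info_op hk hl \<rho> = hk \<circ>\<^sub>m op_adj hl \<circ>\<^sub>m (\<lambda>\<phi>. Some (\<rho> \<phi>))"

definition info_matrix :: "('n::finite \<Rightarrow> 'h::chilbert_space \<rightharpoonup> 'h) \<Rightarrow> ('h \<Rightarrow> 'h) \<Rightarrow> complex^'n^'n"
  where "info_matrix h \<rho> = (\<chi> k l. Tr (\<lambda>\<phi>. the (info_op (h k) (h l) \<rho> \<phi>)))"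

section \<open>Quantum probability measures\<close>

definition qpm :: "'x measure \<Rightarrow> ('x set \<Rightarrow> 'h::chilbert_space \<Rightarrow> 'h) \<Rightarrow> bool"
  where "qpm M P \<longleftrightarrow>
    (\<forall>B\<in>sets M. positive_op (P B)) \<and>
    (\<forall>A \<psi> \<phi>. range A \<subseteq> sets M \<longrightarrow> disjoint_family (A :: nat \<Rightarrow> 'x set) \<longrightarrow>
      (\<lambda>n. cinner \<psi> (P (A n) \<phi>)) sums cinner \<psi> (P (\<Union>n. A n) \<phi>)) \<and>
    P (space M) = id"

definition outcome_distr ::
    "'x measure \<Rightarrow> ('x set \<Rightarrow> 'h::chilbert_space \<Rightarrow> 'h) \<Rightarrow> ('h \<Rightarrow> 'h) \<Rightarrow> 'x measure"
  where "outcome_distr M P \<rho> =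
    measure_of (space M) (sets M) (\<lambda>B. ennreal (Re (Tr (P B \<circ> \<rho>))))"

text \<open>Integral of \<open>f\<close> with respect to a complex measure \<open>\<nu>\<close>: \<open>\<nu>\<close> is written as
  \<open>\<mu>\<^sub>1 - \<mu>\<^sub>2 + \<i>(\<mu>\<^sub>3 - \<mu>\<^sub>4)\<close> with finite positive measures for each of which \<open>f\<close> is integrable.
  The value is independent of the decomposition.\<close>

definition has_complex_measure_integral ::
    "'x measure \<Rightarrow> ('x set \<Rightarrow> complex) \<Rightarrow> ('x \<Rightarrow> complex) \<Rightarrow> complex \<Rightarrow> bool"
  where "has_complex_measure_integral M \<nu> f I \<longleftrightarrow>
    (\<exists>\<mu>1 \<mu>2 \<mu>3 \<mu>4.
      (\<forall>\<mu>\<in>{\<mu>1, \<mu>2, \<mu>3, \<mu>4}. finite_measure \<mu> \<and> sets \<mu> = sets M \<and> integrable \<mu> f) \<and>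
      (\<forall>B\<in>sets M. \<nu> B = complex_of_real (measure \<mu>1 B - measure \<mu>2 B)
                     + \<i> * complex_of_real (measure \<mu>3 B - measure \<mu>4 B)) \<and>
      I = (\<integral>x. f x \<partial>\<mu>1) - (\<integral>x. f x \<partial>\<mu>2) + \<i> * ((\<integral>x. f x \<partial>\<mu>3) - (\<integral>x. f x \<partial>\<mu>4)))"

definition covariance_matrix :: "(complex^'m::finite) measure \<Rightarrow> complex^'m \<Rightarrow> complex^'m^'m"
  where "covariance_matrix \<mu> \<theta> =
    (\<chi> i j. \<integral>x. (x $ i - \<theta> $ i) * cnj (x $ j - \<theta> $ j) \<partial>\<mu>)"

section \<open>Matrices\<close>

definition wirtinger_matrix ::
    "(complex^'n::finite \<Rightarrow> complex^'m::finite) \<Rightarrow> complex^'n \<Rightarrow> complex^'n^'m"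
  where "wirtinger_matrix \<theta> \<alpha> = (\<chi> i k. wirtinger k (\<lambda>\<beta>. \<theta> \<beta> $ i) \<alpha>)"

definition conj_transpose :: "complex^'n::finite^'m::finite \<Rightarrow> complex^'m^'n"
  where "conj_transpose A = (\<chi> i j. cnj (A $ j $ i))"

definition matrix_ge :: "complex^'m::finite^'m \<Rightarrow> complex^'m^'m \<Rightarrow> bool"
  where "matrix_ge A B \<longleftrightarrow>
    conj_transpose (A - B) = A - B \<and>
    (\<forall>z. (\<Sum>i\<in>UNIV. \<Sum>j\<in>UNIV. cnj (z $ i) * (A - B) $ i $ j * z $ j) \<in> \<real>\<^sub>\<ge>\<^sub>0)"

end

theory Submission
  imports Defs
begin

text \<open>Let \<open>e\<close> run through an orthonormal eigenbasis of \<open>\<rho>\<close> with eigenvalues \<open>p\<^sub>e\<close>. Taking adjoints in the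
  defining identity of the logarithmic derivatives gives \<open>\<partial>\<rho>/\<partial>\<alpha>\<^sup>k = h\<^sub>k\<^sup>* \<rho>\<close>, so with \<open>w\<^sub>k(e) = h\<^sub>k\<^sup>* e\<close> the
  information matrix is \<open>H\<^sub>k\<^sub>l = \<Sum>\<^sub>e p\<^sub>e \<langle>w\<^sub>k(e), w\<^sub>l(e)\<rangle>\<close>, the outcome distribution is
  \<open>\<mu>(B) = \<Sum>\<^sub>e p\<^sub>e \<langle>e, P(B) e\<rangle>\<close> and its derivative is \<open>\<nu>\<^sub>k(B) = \<Sum>\<^sub>e p\<^sub>e \<langle>e, P(B) w\<^sub>k(e)\<rangle>\<close>. The Cauchy-Schwarz
  inequality for the positive forms \<open>P(B)\<close>, summed over a partition, gives
  \<open>\<bar>\<integral> f d(\<Sum>\<^sub>k c\<^sub>k \<nu>\<^sub>k)\<bar>\<^sup>2 \<le> (\<integral> \<bar>f\<bar>\<^sup>2 d\<mu>) (c\<^sup>\<dagger> H c)\<close> for simple \<open>f\<close>, and in the limit for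
  \<open>f = \<Sum>\<^sub>i cnj(z\<^sub>i) (\<lambda>\<^sub>i - \<theta>\<^sub>i)\<close>. There the integral on the left is \<open>z\<^sup>\<dagger> D c\<close> by unbiasedness, and
  \<open>c = H\<^sup>-\<^sup>1 D\<^sup>\<dagger> z\<close> gives the bound.\<close>

subsection \<open>The inner product\<close>

lemma scaleC_one [simp]: "1 *\<^sub>C x = (x::'a::complex_inner)"
  using scaleC_of_real[of 1 x] by simp

lemma scaleC_zero_left [simp]: "0 *\<^sub>C x = (0::'a::complex_inner)"
  using scaleC_of_real[of 0 x] by simp

lemma scaleC_zero_right [simp]: "c *\<^sub>C 0 = (0::'a::complex_inner)"
  using scaleC_add_right[of c 0 0] by simp

lemma cinner_add_left: "cinner (x + y) z = cinner x z + cinner y (z::'a::complex_inner)"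
  by (metis cinner_add_right cinner_commute complex_cnj_add)

lemma cinner_scaleC_left: "cinner (c *\<^sub>C x) y = cnj c * cinner x (y::'a::complex_inner)"
  by (metis cinner_scaleC_right cinner_commute complex_cnj_mult)

lemma cinner_zero_right [simp]: "cinner x 0 = 0" for x :: "'a::complex_inner"
  using cinner_add_right[of x 0 0] by simp

lemma cinner_zero_left [simp]: "cinner 0 x = 0" for x :: "'a::complex_inner"
  using cinner_add_left[of 0 0 x] by simp

lemma cinner_minus_right: "cinner x (- y) = - cinner x y" for x :: "'a::complex_inner"
  by (metis add_eq_0_iff cinner_add_right cinner_zero_right add.right_inverse)

lemma cinner_diff_right: "cinner x (y - z) = cinner x y - cinner x z" for x :: "'a::complex_inner"
  by (metis cinner_add_right cinner_minus_right diff_conv_add_uminus)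

lemma cinner_diff_left: "cinner (x - y) z = cinner x z - cinner y z" for x :: "'a::complex_inner"
  by (metis cinner_diff_right cinner_commute complex_cnj_diff)

lemma cinner_sum_right: "cinner x (\<Sum>i\<in>I. f i) = (\<Sum>i\<in>I. cinner x (f i))"
  for x :: "'a::complex_inner"
  by (induction I rule: infinite_finite_induct) (auto simp: cinner_add_right)

lemma cinner_sum_left: "cinner (\<Sum>i\<in>I. f i) x = (\<Sum>i\<in>I. cinner (f i) x)"
  for x :: "'a::complex_inner"
  by (induction I rule: infinite_finite_induct) (auto simp: cinner_add_left)

lemma cinner_scaleR_right: "cinner x (r *\<^sub>R y) = r * cinner x y" for x :: "'a::complex_inner"
  by (metis cinner_scaleC_right scaleC_of_real)

lemma cinner_scaleR_left: "cinner (r *\<^sub>R x) y = r * cinner x y" for x :: "'a::complex_inner"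
  by (metis cinner_scaleC_left scaleC_of_real complex_cnj_complex_of_real)

lemma Re_cinner_self: "Re (cinner x x) = (norm x)\<^sup>2" for x :: "'a::complex_inner"
  by (simp add: cinner_self del: of_real_power)

lemma cinner_self_eq_0 [simp]: "cinner x x = 0 \<longleftrightarrow> x = 0" for x :: "'a::complex_inner"
  by (simp add: cinner_self)

lemma norm_scaleC: "norm (c *\<^sub>C x) = cmod c * norm x" for x :: "'a::complex_inner"
proof -
  have "cinner (c *\<^sub>C x) (c *\<^sub>C x) = (c * cnj c) * cinner x x"
    by (simp add: cinner_scaleC_left cinner_scaleC_right mult_ac)
  then have "complex_of_real ((norm (c *\<^sub>C x))\<^sup>2) = complex_of_real ((cmod c * norm x)\<^sup>2)"
    by (simp only: cinner_self power_mult_distrib of_real_mult complex_norm_square)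
  then show ?thesis
    by (simp only: of_real_eq_iff) (simp add: power2_eq_iff_nonneg)
qed

lemma clinear_bounded_linear: "bounded_clinear A \<Longrightarrow> bounded_linear A"
  by (simp add: bounded_clinear_def)

lemma clinear_add: "bounded_clinear A \<Longrightarrow> A (x + y) = A x + A y"
  by (simp add: bounded_clinear_def bounded_linear.linear linear_add)

lemma clinear_zero: "bounded_clinear A \<Longrightarrow> A 0 = 0"
  by (simp add: bounded_clinear_def bounded_linear.linear linear_0)

lemma clinear_scaleC: "bounded_clinear A \<Longrightarrow> A (c *\<^sub>C x) = c *\<^sub>C A x"
  by (simp add: bounded_clinear_def)

lemma clinear_sum: "bounded_clinear A \<Longrightarrow> A (\<Sum>i\<in>I. f i) = (\<Sum>i\<in>I. A (f i))"
  by (simp add: bounded_clinear_def bounded_linear.linear linear_sum)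

subsection \<open>Positive operators\<close>

lemma positive_op_clinear: "positive_op A \<Longrightarrow> bounded_clinear A"
  by (simp add: positive_op_def)

lemma positive_op_real: "positive_op A \<Longrightarrow> cinner x (A x) = complex_of_real (Re (cinner x (A x)))"
  by (auto simp: positive_op_def complex_nonneg_Reals_iff complex_eq_iff)

lemma positive_op_nonneg: "positive_op A \<Longrightarrow> 0 \<le> Re (cinner x (A x))"
  by (auto simp: positive_op_def complex_nonneg_Reals_iff)

lemma positive_op_id: "positive_op (\<lambda>x::'a::complex_inner. x)"
  by (auto simp: positive_op_def bounded_clinear_def cinner_self complex_nonneg_Reals_iff
      simp del: of_real_power)

text \<open>Polarization: the form is real on the diagonal, so the arguments \<open>x + y\<close>
  and \<open>x + \<i> *\<^sub>C y\<close> force the imaginary and the real part of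
  \<open>cinner x (A y)\<close> and \<open>cnj (cinner y (A x))\<close> to agree.\<close>

lemma positive_op_symmetric:
  assumes "positive_op A"
  shows "cinner (A x) y = cinner x (A y)"
proof -
  note lin = clinear_add[OF positive_op_clinear[OF assms]] clinear_scaleC[OF positive_op_clinear[OF assms]]
  note re = assms[THEN positive_op_real]
  have im: "Im (cinner u (A u)) = 0" for u
    using re[of u] by (metis Im_complex_of_real)
  have 1: "Im (cinner x (A y)) + Im (cinner y (A x)) = 0"
    using im[of "x + y"] im[of x] im[of y] by (simp add: lin cinner_add_right cinner_add_left)
  have 2: "Re (cinner x (A y)) - Re (cinner y (A x)) = 0"
    using im[of "x + \<i> *\<^sub>C y"] im[of x] im[of y]
    by (simp add: lin cinner_add_right cinner_add_left cinner_scaleC_left cinner_scaleC_right)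
  have "cinner x (A y) = cnj (cinner y (A x))"
    using 1 2 by (simp add: complex_eq_iff)
  then show ?thesis
    by (metis cinner_commute)
qed

text \<open>Discriminant argument with a complex variable. Fixing the phase of \<open>c\<close> so
  that \<open>c * s\<close> is real and nonpositive for \<open>t \<ge> 0\<close> leaves a real
  quadratic in \<open>t\<close>.\<close>

lemma quadratic_nonneg_imp_cmod_le:
  fixes s :: complex
  assumes "\<And>c. 0 \<le> a + 2 * Re (c * s) + (cmod c)\<^sup>2 * b" "0 \<le> b"
  shows "(cmod s)\<^sup>2 \<le> a * b"
proof -
  have *: "0 \<le> a - 2 * t * (cmod s)\<^sup>2 + t\<^sup>2 * (cmod s)\<^sup>2 * b" for t :: real
  proof -
    have "Re (- complex_of_real t * cnj s * s) = - t * (cmod s)\<^sup>2"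
      unfolding cmod_power2 by (simp add: power2_eq_square algebra_simps)
    then show ?thesis
      using assms(1)[of "- complex_of_real t * cnj s"]
      by (simp add: norm_mult power_mult_distrib)
  qed
  show ?thesis
  proof (cases "b = 0")
    case True
    show ?thesis
    proof (cases "s = 0")
      case False
      then have "(cmod s)\<^sup>2 > 0" by simp
      then show ?thesis
        \<comment> \<open>For \<open>b = 0\<close> the bound is affine in \<open>t\<close>; this
          choice makes it equal to -1.\<close>
        using *[of "(a + 1) / (2 * (cmod s)\<^sup>2)"] True by (simp add: field_simps)
    qed (use True in auto)
  next
    case False
    then have "b > 0" using assms by simp
    then have "0 \<le> a - (cmod s)\<^sup>2 / b"
      \<comment> \<open>The minimum of the quadratic is attained at
        \<open>t = 1 / b\<close>.\<close>
      using *[of "1 / b"] by (simp add: field_simps power2_eq_square)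
    then show ?thesis
      using \<open>b > 0\<close> by (simp add: field_simps)
  qed
qed

text \<open>Expanding the nonnegative form at \<open>x + c *\<^sub>C y\<close> gives the quadratic
  of the preceding lemma; symmetry of \<open>A\<close> makes the two cross terms conjugate. The form
  may be degenerate, as it usually is for the operators \<open>P B\<close>.\<close>

lemma positive_op_Cauchy_Schwarz:
  assumes "positive_op A"
  shows "(cmod (cinner x (A y)))\<^sup>2 \<le> Re (cinner x (A x)) * Re (cinner y (A y))"
proof (rule quadratic_nonneg_imp_cmod_le)
  note lin = clinear_add[OF positive_op_clinear[OF assms]] clinear_scaleC[OF positive_op_clinear[OF assms]]
  fix c
  have "cinner (x + c *\<^sub>C y) (A (x + c *\<^sub>C y))
    = cinner x (A x) + (c * cinner x (A y) + cnj (c * cinner x (A y))) + (c * cnj c) * cinner y (A y)"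
    using cinner_commute[of "A y" x] positive_op_symmetric[OF assms, of y x]
    by (simp add: lin cinner_add_right cinner_add_left cinner_scaleC_left cinner_scaleC_right
        algebra_simps)
  moreover have "Re ((c * cnj c) * cinner y (A y)) = (cmod c)\<^sup>2 * Re (cinner y (A y))"
    by (subst complex_norm_square[symmetric]) (simp del: of_real_power)
  ultimately have "Re (cinner (x + c *\<^sub>C y) (A (x + c *\<^sub>C y)))
    = Re (cinner x (A x)) + 2 * Re (c * cinner x (A y)) + (cmod c)\<^sup>2 * Re (cinner y (A y))"
    by (simp only: plus_complex.sel complex_cnj) (simp del: times_complex.sel complex_cnj_mult)
  then show "0 \<le> Re (cinner x (A x)) + 2 * Re (c * cinner x (A y)) + (cmod c)\<^sup>2 * Re (cinner y (A y))"
    using positive_op_nonneg[OF assms, of "x + c *\<^sub>C y"] by simp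
qed (rule positive_op_nonneg[OF assms])

lemma cinner_Cauchy_Schwarz: "cmod (cinner x y) \<le> norm x * norm y" for x :: "'a::complex_inner"
  using positive_op_Cauchy_Schwarz[OF positive_op_id, of x y]
  by (simp add: Re_cinner_self power_mult_distrib[symmetric] power2_le_iff_abs_le)

lemma bounded_linear_cinner_right: "bounded_linear (cinner x)" for x :: "'a::complex_inner"
  by (rule bounded_linear_intro[where K = "norm x"])
    (use cinner_Cauchy_Schwarz[of x] in \<open>auto simp: cinner_add_right cinner_scaleR_right scaleR_conv_of_real mult.commute\<close>)

lemma bounded_linear_cinner_left: "bounded_linear (\<lambda>y. cinner y x)" for x :: "'a::complex_inner"
  by (rule bounded_linear_intro[where K = "norm x"])
    (use cinner_Cauchy_Schwarz[of _ x] in \<open>auto simp: cinner_add_left cinner_scaleR_left scaleR_conv_of_real\<close>)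

text \<open>The kernel of \<open>cinner (x - y)\<close> is closed, hence everything. This makes the
  adjoint of a densely defined operator single-valued.\<close>

lemma cinner_eq_on_dense:
  fixes x y :: "'a::complex_inner"
  assumes "closure S = UNIV" "\<And>z. z \<in> S \<Longrightarrow> cinner x z = cinner y z"
  shows "x = y"
proof -
  have "closed {z. cinner (x - y) z = 0}"
    by (intro closed_Collect_eq linear_continuous_on bounded_linear_cinner_right continuous_on_const)
  moreover have "S \<subseteq> {z. cinner (x - y) z = 0}"
    using assms(2) by (auto simp: cinner_diff_left)
  ultimately have "cinner (x - y) (x - y) = 0"
    using assms(1) closure_minimal by blast
  then show ?thesis by simp
qed

subsection \<open>Orthonormal sets\<close>

text \<open>Orthonormality without completeness is the property that passes to subsets and to unions
  of chains, as Zorn's lemma requires.\<close>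

definition orthonormal_set :: "'a::complex_inner set \<Rightarrow> bool"
  where "orthonormal_set E \<longleftrightarrow>
    (\<forall>e\<in>E. norm e = 1) \<and> (\<forall>e\<in>E. \<forall>f\<in>E. e \<noteq> f \<longrightarrow> cinner e f = 0)"

lemma orthonormal_setD:
  assumes "orthonormal_set E" "e \<in> E" "f \<in> E"
  shows "cinner e f = (if e = f then 1 else 0)"
  using assms by (auto simp: orthonormal_set_def cinner_self)

lemma orthonormal_set_subset: "orthonormal_set E \<Longrightarrow> F \<subseteq> E \<Longrightarrow> orthonormal_set F"
  by (simp add: orthonormal_set_def subset_iff)

lemma orthonormal_set_insert:
  assumes "orthonormal_set E" "norm x = 1" "\<And>e. e \<in> E \<Longrightarrow> cinner e x = 0"
  shows "orthonormal_set (insert x E)"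
proof -
  have "cinner x e = 0" if "e \<in> E" for e
    using assms(3)[OF that] cinner_commute[of x e] by simp
  then show ?thesis
    using assms by (auto simp: orthonormal_set_def)
qed

lemma orthonormal_basis_iff:
  "orthonormal_basis E \<longleftrightarrow> orthonormal_set E \<and> (\<forall>\<psi>. (\<forall>e\<in>E. cinner e \<psi> = 0) \<longrightarrow> \<psi> = 0)"
  by (simp add: orthonormal_basis_def orthonormal_set_def)

text \<open>Zorn's lemma relative to an arbitrary set \<open>V\<close>. With \<open>V = UNIV\<close>
  it produces bases; with \<open>V\<close> the set of eigenvectors it produces a maximal orthonormal
  system of eigenvectors.\<close>

lemma extend_orthonormal_set:
  fixes S V :: "'a::complex_inner set"
  assumes "orthonormal_set S" "S \<subseteq> V"
  obtains E where "S \<subseteq> E" "E \<subseteq> V" "orthonormal_set E"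
    "\<And>x. x \<in> V \<Longrightarrow> norm x = 1 \<Longrightarrow> \<exists>e\<in>E. cinner e x \<noteq> 0"
proof -
  let ?\<A> = "{E. S \<subseteq> E \<and> E \<subseteq> V \<and> orthonormal_set E}"
  have "\<exists>M\<in>?\<A>. \<forall>X\<in>?\<A>. M \<subseteq> X \<longrightarrow> X = M"
  proof (rule subset_Zorn_nonempty)
    show "?\<A> \<noteq> {}" using assms by auto
    fix \<C> assume "\<C> \<noteq> {}" and ch: "subset.chain ?\<A> \<C>"
    have "orthonormal_set (\<Union>\<C>)"
      unfolding orthonormal_set_def
    proof (intro conjI ballI impI)
      fix e assume "e \<in> \<Union>\<C>"
      then show "norm e = 1"
        using ch by (auto simp: subset.chain_def orthonormal_set_def)
    next
      fix e f assume "e \<in> \<Union>\<C>" "f \<in> \<Union>\<C>" "e \<noteq> f"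
      then obtain A B where AB: "A \<in> \<C>" "B \<in> \<C>" "e \<in> A" "f \<in> B" by blast
      then have "A \<subseteq> B \<or> B \<subseteq> A"
        using ch unfolding subset_chain_def by blast
      then obtain C where "C \<in> \<C>" "e \<in> C" "f \<in> C" using AB by blast
      moreover have "orthonormal_set C"
        using ch \<open>C \<in> \<C>\<close> by (auto simp: subset.chain_def)
      ultimately show "cinner e f = 0"
        using \<open>e \<noteq> f\<close> by (auto simp: orthonormal_set_def)
    qed
    moreover have "\<forall>C\<in>\<C>. S \<subseteq> C \<and> C \<subseteq> V"
      using ch unfolding subset.chain_def by auto
    then have "S \<subseteq> \<Union>\<C>" "\<Union>\<C> \<subseteq> V"
      using \<open>\<C> \<noteq> {}\<close> by blast+
    ultimately show "\<Union>\<C> \<in> ?\<A>" by blast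
  qed
  then obtain E where E: "S \<subseteq> E" "E \<subseteq> V" "orthonormal_set E"
    and max: "\<And>X. S \<subseteq> X \<Longrightarrow> X \<subseteq> V \<Longrightarrow> orthonormal_set X \<Longrightarrow> E \<subseteq> X \<Longrightarrow> X = E"
    by auto
  show ?thesis
  proof (rule that[OF E])
    fix x assume x: "x \<in> V" "norm x = 1"
    show "\<exists>e\<in>E. cinner e x \<noteq> 0"
    proof (rule ccontr)
      assume "\<not> ?thesis"
      then have *: "\<And>e. e \<in> E \<Longrightarrow> cinner e x = 0" by auto
      \<comment> \<open>By maximality \<open>x\<close> already lies in \<open>E\<close>, so it would
        be orthogonal to itself.\<close>
      then have "insert x E = E"
        using E x by (intro max orthonormal_set_insert) auto
      then have "cinner x x = 0" using * by blast
      then show False using x by auto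
    qed
  qed
qed

text \<open>Maximality among all orthonormal sets means completeness: a nonzero vector orthogonal to
  \<open>E\<close> could be normalized and adjoined.\<close>

lemma extend_orthonormal_basis:
  fixes S :: "'h::chilbert_space set"
  assumes "orthonormal_set S"
  obtains E where "S \<subseteq> E" "orthonormal_basis E"
proof -
  obtain E where E: "S \<subseteq> E" "orthonormal_set E"
    and max: "\<And>x. norm x = 1 \<Longrightarrow> \<exists>e\<in>E. cinner e x \<noteq> 0"
    using extend_orthonormal_set[OF assms, of UNIV] by auto
  have "\<psi> = 0" if "\<And>e. e \<in> E \<Longrightarrow> cinner e \<psi> = 0" for \<psi>
  proof (rule ccontr)
    assume "\<psi> \<noteq> 0"
    then obtain e where "e \<in> E" "cinner e ((1 / norm \<psi>) *\<^sub>R \<psi>) \<noteq> 0"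
      using max[of "(1 / norm \<psi>) *\<^sub>R \<psi>"] by auto
    then show False using that by (simp add: cinner_scaleR_right)
  qed
  then show ?thesis
    using that E by (auto simp: orthonormal_basis_iff)
qed

lemma orthonormal_basis_exists: "\<exists>E::'h::chilbert_space set. orthonormal_basis E"
proof -
  have "orthonormal_set ({}::'h set)"
    by (simp add: orthonormal_set_def)
  then show ?thesis
    using extend_orthonormal_basis by blast
qed

lemma orthonormal_sum_residual:
  fixes x :: "'a::complex_inner"
  assumes "orthonormal_set E" "finite F" "F \<subseteq> E" "e \<in> F"
  shows "cinner e (x - (\<Sum>f\<in>F. cinner f x *\<^sub>C f)) = 0"
proof -
  have "cinner e (\<Sum>f\<in>F. cinner f x *\<^sub>C f) = (\<Sum>f\<in>F. if f = e then cinner f x else 0)"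
    unfolding cinner_sum_right using assms
    by (intro sum.cong) (auto simp: cinner_scaleC_right subset_iff orthonormal_setD[OF assms(1)])
  then show ?thesis
    using assms by (simp add: cinner_diff_right)
qed

lemma orthonormal_norm_sum:
  fixes c :: "'a::complex_inner \<Rightarrow> complex"
  assumes "orthonormal_set E" "finite F" "F \<subseteq> E"
  shows "(norm (\<Sum>f\<in>F. c f *\<^sub>C f))\<^sup>2 = (\<Sum>f\<in>F. (cmod (c f))\<^sup>2)"
proof -
  have "cinner (\<Sum>f\<in>F. c f *\<^sub>C f) (\<Sum>f\<in>F. c f *\<^sub>C f)
    = (\<Sum>f\<in>F. \<Sum>g\<in>F. if f = g then cnj (c f) * c f else 0)"
    unfolding cinner_sum_right cinner_sum_left using assms
    by (intro sum.cong) (auto simp: cinner_scaleC_right cinner_scaleC_left orthonormal_setD subset_iff)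
  also have "\<dots> = (\<Sum>f\<in>F. complex_of_real ((cmod (c f))\<^sup>2))"
    using assms by (simp add: complex_norm_square mult.commute del: of_real_power)
  also have "\<dots> = complex_of_real (\<Sum>f\<in>F. (cmod (c f))\<^sup>2)"
    by simp
  finally show ?thesis
    unfolding cinner_self by (simp only: of_real_eq_iff)
qed

lemma norm_add_orthogonal:
  fixes x y :: "'a::complex_inner"
  assumes "cinner x y = 0"
  shows "(norm (x + y))\<^sup>2 = (norm x)\<^sup>2 + (norm y)\<^sup>2"
proof -
  have "cinner y x = 0" using assms cinner_commute[of y x] by simp
  then have "cinner (x + y) (x + y) = cinner x x + cinner y y"
    using assms by (simp add: cinner_add_left cinner_add_right)
  then show ?thesis
    unfolding cinner_self by (simp only: of_real_eq_iff flip: of_real_add)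
qed

lemma orthonormal_pythagoras:
  fixes x :: "'a::complex_inner"
  assumes "orthonormal_set E" "finite F" "F \<subseteq> E"
  shows "(norm x)\<^sup>2 = (\<Sum>f\<in>F. (cmod (cinner f x))\<^sup>2)
    + (norm (x - (\<Sum>f\<in>F. cinner f x *\<^sub>C f)))\<^sup>2"
proof -
  let ?y = "\<Sum>f\<in>F. cinner f x *\<^sub>C f"
  have "cinner ?y (x - ?y) = 0"
    unfolding cinner_sum_left
    by (intro sum.neutral) (simp add: cinner_scaleC_left orthonormal_sum_residual[OF assms])
  from norm_add_orthogonal[OF this] show ?thesis
    by (simp add: orthonormal_norm_sum[OF assms])
qed

lemma Bessel_inequality:
  fixes x :: "'a::complex_inner"
  assumes "orthonormal_set E" "finite F" "F \<subseteq> E"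
  shows "(\<Sum>f\<in>F. (cmod (cinner f x))\<^sup>2) \<le> (norm x)\<^sup>2"
  using orthonormal_pythagoras[OF assms, of x] by simp

lemma Bessel_summable:
  fixes x :: "'a::complex_inner"
  assumes "orthonormal_set E"
  shows "(\<lambda>e. (cmod (cinner e x))\<^sup>2) summable_on E"
    "(\<Sum>\<^sub>\<infinity>e\<in>E. (cmod (cinner e x))\<^sup>2) \<le> (norm x)\<^sup>2"
proof -
  show 1: "(\<lambda>e. (cmod (cinner e x))\<^sup>2) summable_on E"
    by (rule nonneg_bdd_above_summable_on)
      (auto intro!: bdd_aboveI2[where M = "(norm x)\<^sup>2"] Bessel_inequality[OF assms])
  show "(\<Sum>\<^sub>\<infinity>e\<in>E. (cmod (cinner e x))\<^sup>2) \<le> (norm x)\<^sup>2"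
    by (rule has_sum_le_finite_sums[OF has_sum_infsum[OF 1]]) (auto intro: Bessel_inequality[OF assms])
qed

text \<open>Bessel's inequality makes the squared coefficients summable, Pythagoras turns this into
  the Cauchy property of the partial sums, and completeness gives a limit. The limit has the same
  coefficients as \<open>x\<close>, so it equals \<open>x\<close>.\<close>

lemma orthonormal_expansion:
  fixes x :: "'h::chilbert_space"
  assumes E: "orthonormal_basis E"
  shows "((\<lambda>e. cinner e x *\<^sub>C e) has_sum x) E"
proof -
  have on: "orthonormal_set E"
    using E by (simp add: orthonormal_basis_iff)
  let ?f = "\<lambda>e. cinner e x *\<^sub>C e" and ?q = "\<lambda>e. (cmod (cinner e x))\<^sup>2"
  define s where "s = (\<Sum>\<^sub>\<infinity>e\<in>E. ?q e)"
  have hs: "(?q has_sum s) E"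
    unfolding s_def by (rule has_sum_infsum[OF Bessel_summable(1)[OF on]])
  have ub: "sum ?q F \<le> s" if "finite F" "F \<subseteq> E" for F
    using finite_sum_le_has_sum[OF hs that(1,2)] by simp
  \<comment> \<open>The tolerance is squared because the missing coefficient mass is a squared
    distance.\<close>
  have "\<forall>n. \<exists>F. finite F \<and> F \<subseteq> E \<and> s - sum ?q F < (inverse (real (Suc n)))\<^sup>2"
  proof
    fix n
    obtain F where "finite F" "F \<subseteq> E" "dist (sum ?q F) s \<le> (inverse (real (Suc n)))\<^sup>2 / 2"
      using has_sum_finite_approximation[OF hs, of "(inverse (real (Suc n)))\<^sup>2 / 2"] by auto
    moreover have "0 < (inverse (real (Suc n)))\<^sup>2" by simp
    ultimately show "\<exists>F. finite F \<and> F \<subseteq> E \<and> s - sum ?q F < (inverse (real (Suc n)))\<^sup>2"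
      unfolding dist_real_def by (intro exI[of _ F] conjI) linarith+
  qed
  then obtain F where F: "\<And>n. finite (F n)" "\<And>n. F n \<subseteq> E"
    and Fs: "\<And>n. s - sum ?q (F n) < (inverse (real (Suc n)))\<^sup>2" by metis
  have close: "norm (sum ?f G - sum ?f (F n)) < inverse (real (Suc n))"
    if G: "finite G" "F n \<subseteq> G" "G \<subseteq> E" for G n
  proof -
    have "(norm (sum ?f G - sum ?f (F n)))\<^sup>2 = (norm (sum ?f (G - F n)))\<^sup>2"
      using G F by (simp add: sum_diff)
    also have "\<dots> = sum ?q (G - F n)"
      using G by (intro orthonormal_norm_sum[OF on]) auto
    also have "\<dots> = sum ?q G - sum ?q (F n)"
      using G F by (simp add: sum_diff)
    also have "\<dots> < (inverse (real (Suc n)))\<^sup>2"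
      using Fs[of n] ub[OF G(1,3)] by linarith
    finally show ?thesis
      by (rule power_less_imp_less_base) simp
  qed
  \<comment> \<open>The sets \<open>F n\<close> need not be nested, so both sums are compared with
    the sum over \<open>F m \<union> F n\<close>.\<close>
  have close2: "norm (sum ?f (F m) - sum ?f (F n)) < inverse (real (Suc m)) + inverse (real (Suc n))" for m n
  proof -
    have "norm (sum ?f (F m \<union> F n) - sum ?f (F m)) < inverse (real (Suc m))"
      "norm (sum ?f (F m \<union> F n) - sum ?f (F n)) < inverse (real (Suc n))"
      by (rule close; use F in simp)+
    then show ?thesis
      using norm_triangle_ineq4[of "sum ?f (F m \<union> F n) - sum ?f (F n)" "sum ?f (F m \<union> F n) - sum ?f (F m)"]
      by simp
  qed
  have "Cauchy (\<lambda>n. sum ?f (F n))"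
  proof (rule metric_CauchyI)
    fix e :: real assume "0 < e"
    then obtain N where N: "inverse (real (Suc N)) < e / 2"
      using reals_Archimedean[of "e/2"] by auto
    have small: "inverse (real (Suc n)) < e / 2" if "n \<ge> N" for n
      by (rule le_less_trans[OF _ N]) (use that in \<open>simp add: field_simps\<close>)
    then have "dist (sum ?f (F m)) (sum ?f (F n)) < e" if "m \<ge> N" "n \<ge> N" for m n
      using close2[of m n] small[OF that(1)] small[OF that(2)] unfolding dist_norm by linarith
    then show "\<exists>M. \<forall>m\<ge>M. \<forall>n\<ge>M. dist (sum ?f (F m)) (sum ?f (F n)) < e"
      by blast
  qed
  then obtain y where y: "(\<lambda>n. sum ?f (F n)) \<longlonglongrightarrow> y"
    using Cauchy_convergent convergent_def by blast
  have hsy: "(?f has_sum y) E"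
    unfolding has_sum_def
  proof (rule tendstoI)
    fix e :: real assume "0 < e"
    have "\<forall>\<^sub>F n in sequentially. dist (sum ?f (F n)) y < e / 2"
      by (rule tendstoD[OF y]) (use \<open>0 < e\<close> in simp)
    moreover have "\<forall>\<^sub>F n in sequentially. inverse (real (Suc n)) < e / 2"
      by (rule order_tendstoD(2)[OF LIMSEQ_inverse_real_of_nat]) (use \<open>0 < e\<close> in simp)
    ultimately have "\<forall>\<^sub>F n in sequentially. dist (sum ?f (F n)) y < e / 2 \<and> inverse (real (Suc n)) < e / 2"
      by (rule eventually_conj)
    then obtain n where n: "dist (sum ?f (F n)) y < e / 2" "inverse (real (Suc n)) < e / 2"
      using eventually_happens'[OF sequentially_bot] by blast
    show "\<forall>\<^sub>F G in finite_subsets_at_top E. dist (sum ?f G) y < e"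
      unfolding eventually_finite_subsets_at_top
    proof (intro exI[of _ "F n"] conjI allI impI F)
      fix G assume "finite G \<and> F n \<subseteq> G \<and> G \<subseteq> E"
      then have "dist (sum ?f G) (sum ?f (F n)) < e / 2"
        using close[of G n] n by (simp add: dist_norm)
      then show "dist (sum ?f G) y < e"
        using n dist_triangle[of "sum ?f G" y "sum ?f (F n)"] by linarith
    qed
  qed
  have "x - y = 0"
  proof -
    have "cinner e (x - y) = 0" if "e \<in> E" for e
    proof -
      have "((\<lambda>f. cinner e (?f f)) has_sum cinner e y) E"
        by (rule has_sum_bounded_linear[OF bounded_linear_cinner_right hsy])
      moreover have "((\<lambda>f. cinner e (?f f)) has_sum cinner e x) E"
        by (rule has_sum_finite_neutralI[of "{e}"])
          (use that in \<open>auto simp: cinner_scaleC_right orthonormal_setD[OF on]\<close>)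
      ultimately show ?thesis
        by (simp add: cinner_diff_right has_sum_unique)
    qed
    then show ?thesis using E unfolding orthonormal_basis_iff by blast
  qed
  then show ?thesis using hsy by simp
qed

lemma Parseval:
  fixes x y :: "'h::chilbert_space"
  assumes "orthonormal_basis E"
  shows "((\<lambda>e. cinner e y * cinner x e) has_sum cinner x y) E"
  using has_sum_bounded_linear[OF bounded_linear_cinner_right orthonormal_expansion[OF assms], of x y]
  by (simp add: cinner_scaleC_right)

text \<open>Existence of a basis is essential here: without one, \<open>has_trace\<close> would hold
  vacuously for every value.\<close>

lemma has_trace_unique:
  assumes "has_trace A s" "has_trace A t"
  shows "s = t"
proof -
  obtain E :: "'a set" where "orthonormal_basis E"
    using orthonormal_basis_exists by blast
  then show ?thesis
    using assms has_sum_unique unfolding has_trace_def by blast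
qed

lemma Tr_eqI: "has_trace A t \<Longrightarrow> Tr A = t"
  unfolding Tr_def by (rule the_equality) (auto intro: has_trace_unique)

lemma has_sum_Tr:
  assumes "\<exists>t. has_trace A t" "orthonormal_basis E"
  shows "((\<lambda>e. cinner e (A e)) has_sum Tr A) E"
proof -
  obtain t where t: "has_trace A t" using assms by blast
  then show ?thesis
    using assms(2) Tr_eqI[OF t] by (simp add: has_trace_def)
qed

subsection \<open>Spectral decomposition of positive operators with a trace\<close>

text \<open>Any finite orthonormal set extends to a basis, in which the trace is the same and all
  diagonal terms are nonnegative.\<close>

lemma positive_trace_le:
  fixes T :: "'h::chilbert_space \<Rightarrow> 'h"
  assumes T: "positive_op T" "has_trace T t" and on: "orthonormal_set F" and fin: "finite F"
  shows "(\<Sum>e\<in>F. Re (cinner e (T e))) \<le> Re t"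
proof -
  obtain E where E: "F \<subseteq> E" "orthonormal_basis E"
    using extend_orthonormal_basis[OF on] by blast
  have "((\<lambda>e. Re (cinner e (T e))) has_sum Re t) E"
    using T(2) E(2) by (intro has_sum_Re) (simp add: has_trace_def)
  then show ?thesis
    by (rule finite_sum_le_has_sum) (use fin E(1) positive_op_nonneg[OF T(1)] in auto)
qed

lemma Re_cinner_scaleR:
  fixes x :: "'a::complex_inner"
  assumes "bounded_clinear T"
  shows "Re (cinner (r *\<^sub>R x) (T (r *\<^sub>R x))) = r\<^sup>2 * Re (cinner x (T x))"
  by (simp add: clinear_scaleC[OF assms] cinner_scaleC_left cinner_scaleC_right power2_eq_square
      flip: scaleC_of_real)

text \<open>Cauchy-Schwarz for the form of \<open>T\<close> at the vectors \<open>T x\<close> and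
  \<open>x\<close>, followed by cancelling one factor \<open>(norm (T x))\<^sup>2\<close>. This
  replaces an argument with the square root of \<open>T\<close>. The bound is assumed only at
  \<open>T x\<close>, so it may come from an invariant set.\<close>

lemma positive_op_norm_le:
  assumes T: "positive_op T" and le: "Re (cinner (T x) (T (T x))) \<le> C * (norm (T x))\<^sup>2"
  shows "(norm (T x))\<^sup>2 \<le> C * Re (cinner x (T x))"
proof (cases "T x = 0")
  case False
  let ?n = "(norm (T x))\<^sup>2"
  have "?n\<^sup>2 = (cmod (cinner (T x) (T x)))\<^sup>2"
    by (simp add: cinner_self del: of_real_power)
  also have "\<dots> \<le> Re (cinner (T x) (T (T x))) * Re (cinner x (T x))"
    by (rule positive_op_Cauchy_Schwarz[OF T])
  also have "\<dots> \<le> C * ?n * Re (cinner x (T x))"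
    by (intro mult_right_mono le positive_op_nonneg[OF T])
  finally have "?n * ?n \<le> ?n * (C * Re (cinner x (T x)))"
    by (simp add: power2_eq_square mult_ac)
  moreover have "0 < ?n" using False by simp
  ultimately show ?thesis by (metis mult_le_cancel_left_pos)
qed simp

text \<open>As \<^term>\<open>F\<close> together with the normalized \<^term>\<open>y\<close> extends to an orthonormal basis, the
  basis independence of the trace bounds the tail of \<^term>\<open>T\<close> without expanding \<^term>\<open>y\<close>.\<close>

lemma positive_trace_form_le:
  fixes T :: "'h::chilbert_space \<Rightarrow> 'h"
  assumes T: "positive_op T" "has_trace T t" and F: "orthonormal_set F" "finite F"
    and y: "\<And>e. e \<in> F \<Longrightarrow> cinner e y = 0"
  shows "Re (cinner y (T y)) \<le> (Re t - (\<Sum>e\<in>F. Re (cinner e (T e)))) * (norm y)\<^sup>2"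
proof (cases "y = 0")
  case False
  define u where "u = (1 / norm y) *\<^sub>R y"
  have u: "norm u = 1" "\<And>e. e \<in> F \<Longrightarrow> cinner e u = 0"
    using False y by (simp_all add: u_def cinner_scaleR_right)
  \<comment> \<open>Otherwise \<open>u\<close> would be orthogonal to itself.\<close>
  then have "u \<notin> F" by force
  have "orthonormal_set (insert u F)"
    using F(1) u by (rule orthonormal_set_insert)
  from positive_trace_le[OF T this] have "Re (cinner u (T u)) \<le> Re t - (\<Sum>e\<in>F. Re (cinner e (T e)))"
    using F(2) \<open>u \<notin> F\<close> by simp
  moreover have "Re (cinner y (T y)) = Re (cinner u (T u)) * (norm y)\<^sup>2"
    unfolding u_def Re_cinner_scaleR[OF positive_op_clinear[OF T(1)]] using False by (simp add: field_simps)
  ultimately show ?thesis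
    by (simp add: mult_right_mono)
qed (simp add: clinear_zero[OF positive_op_clinear[OF T(1)]])

lemma positive_trace_bound:
  fixes T :: "'h::chilbert_space \<Rightarrow> 'h"
  assumes "positive_op T" "has_trace T t"
  shows "Re (cinner y (T y)) \<le> Re t * (norm y)\<^sup>2"
  using positive_trace_form_le[OF assms, of "{}" y] by (simp add: orthonormal_set_def)

lemma bounded_linear_scaleC_left: "bounded_linear (\<lambda>c. c *\<^sub>C x)" for x :: "'a::complex_inner"
  by (rule bounded_linear_intro[where K = "norm x"])
    (auto simp: scaleC_add_left norm_scaleC scaleR_conv_of_real scaleC_scaleC[symmetric] scaleC_of_real)

text \<open>Induction on \<open>F\<close>: a new vector adds the continuous image of the closed unit
  disc, and Minkowski sums of compact sets are compact. It handles the finite-dimensional part of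
  the operator below.\<close>

lemma compact_bounded_combinations:
  fixes g :: "'i \<Rightarrow> 'a::complex_inner"
  assumes "finite F"
  shows "compact {\<Sum>f\<in>F. c f *\<^sub>C g f | c. \<forall>f\<in>F. cmod (c f) \<le> 1}"
  using assms
proof (induction F rule: finite_induct)
  case (insert a F)
  let ?K = "{\<Sum>f\<in>F. c f *\<^sub>C g f | c. \<forall>f\<in>F. cmod (c f) \<le> 1}"
  have "compact ((\<lambda>c. c *\<^sub>C g a) ` cball 0 1)"
    by (intro compact_continuous_image linear_continuous_on bounded_linear_scaleC_left compact_cball)
  from compact_sums[OF this insert.IH]
  have "compact {x + y | x y. x \<in> (\<lambda>c. c *\<^sub>C g a) ` cball 0 1 \<and> y \<in> ?K}" .
  also have "{x + y | x y. x \<in> (\<lambda>c. c *\<^sub>C g a) ` cball 0 1 \<and> y \<in> ?K}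
    = {\<Sum>f\<in>insert a F. c f *\<^sub>C g f | c. \<forall>f\<in>insert a F. cmod (c f) \<le> 1}" (is "?L = ?R")
  proof
    show "?L \<subseteq> ?R"
    proof
      fix z assume "z \<in> ?L"
      then obtain b c where bc: "cmod b \<le> 1" "\<forall>f\<in>F. cmod (c f) \<le> 1"
        "z = b *\<^sub>C g a + (\<Sum>f\<in>F. c f *\<^sub>C g f)" by auto
      have "(\<Sum>f\<in>F. (c(a := b)) f *\<^sub>C g f) = (\<Sum>f\<in>F. c f *\<^sub>C g f)"
        using insert by (intro sum.cong) auto
      then have "z = (\<Sum>f\<in>insert a F. (c(a := b)) f *\<^sub>C g f)"
        using bc insert by simp
      then show "z \<in> ?R" using bc by (auto intro!: exI[of _ "c(a := b)"])
    qed
    show "?R \<subseteq> ?L" using insert by force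
  qed
  finally show ?case .
qed simp

text \<open>Compactness of \<open>T\<close> by total boundedness: on the span of a finite part
  \<open>F\<close> of a basis the image of the ball lies in a compact set, and on the orthogonal
  complement \<open>T\<close> is uniformly small because \<open>F\<close> carries almost all of the
  trace.\<close>

lemma compact_closure_positive_trace:
  fixes T :: "'h::chilbert_space \<Rightarrow> 'h"
  assumes T: "positive_op T" "has_trace T t"
  shows "compact (closure (T ` cball 0 1))"
  unfolding compact_eq_totally_bounded
proof (intro conjI allI impI)
  show "complete (closure (T ` cball 0 1))" by (simp add: complete_eq_closed)
  note lin = positive_op_clinear[OF T(1)]
  fix \<epsilon> :: real assume "0 < \<epsilon>"
  have t0: "0 \<le> Re t"
    using positive_trace_le[OF T, of "{}"] by (simp add: orthonormal_set_def)
  \<comment> \<open>Chosen so that \<open>Re t * \<delta> \<le> (\<epsilon> / 4)\<^sup>2\<close>;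
    the summand 1 covers \<open>Re t = 0\<close>.\<close>
  define \<delta> where "\<delta> = (\<epsilon> / 4)\<^sup>2 / (Re t + 1)"
  have \<delta>: "\<delta> > 0" "Re t * \<delta> \<le> (\<epsilon> / 4)\<^sup>2"
    using \<open>0 < \<epsilon>\<close> t0 by (auto simp: \<delta>_def field_simps)
  obtain E :: "'h set" where E: "orthonormal_basis E"
    using orthonormal_basis_exists by blast
  then have on: "orthonormal_set E" by (simp add: orthonormal_basis_iff)
  have "((\<lambda>e. Re (cinner e (T e))) has_sum Re t) E"
    using T(2) E by (intro has_sum_Re) (simp add: has_trace_def)
  from has_sum_finite_approximation[OF this \<delta>(1)]
  obtain F where F: "finite F" "F \<subseteq> E" "dist (\<Sum>e\<in>F. Re (cinner e (T e))) (Re t) \<le> \<delta>"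
    by auto
  have onF: "orthonormal_set F"
    using orthonormal_set_subset[OF on F(2)] .
  let ?K = "{\<Sum>f\<in>F. c f *\<^sub>C T f | c. \<forall>f\<in>F. cmod (c f) \<le> 1}"
  have "compact ?K"
    by (rule compact_bounded_combinations[OF F(1)])
  then obtain k where k: "finite k" "?K \<subseteq> (\<Union>x\<in>k. ball x (\<epsilon> / 4))"
    using \<open>0 < \<epsilon>\<close> compact_eq_totally_bounded[of ?K] by (auto dest: spec[of _ "\<epsilon> / 4"])
  have "T ` cball 0 1 \<subseteq> (\<Union>x\<in>k. cball x (\<epsilon> / 2))"
  proof
    fix z assume "z \<in> T ` cball 0 1"
    then obtain x where x: "norm x \<le> 1" "z = T x" by auto
    let ?s = "\<Sum>f\<in>F. cinner f x *\<^sub>C f"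
    define y where "y = x - ?s"
    have "(norm x)\<^sup>2 = (\<Sum>f\<in>F. (cmod (cinner f x))\<^sup>2) + (norm y)\<^sup>2"
      using orthonormal_pythagoras[OF on F(1,2), of x] by (simp add: y_def)
    then have "(norm y)\<^sup>2 \<le> (norm x)\<^sup>2"
      by (simp add: sum_nonneg)
    also have "\<dots> \<le> 1" using x by (simp add: power_le_one)
    finally have y1: "(norm y)\<^sup>2 \<le> 1" .
    \<comment> \<open>The residual \<open>y\<close> is orthogonal to \<open>F\<close>, so its form
      is bounded by the trace left outside \<open>F\<close>, which is at most
      \<open>\<delta>\<close>.\<close>
    have "Re (cinner y (T y)) \<le> (Re t - (\<Sum>e\<in>F. Re (cinner e (T e)))) * (norm y)\<^sup>2"
      by (rule positive_trace_form_le[OF T onF F(1)])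
        (simp add: y_def orthonormal_sum_residual[OF on F(1,2)])
    also have "\<dots> \<le> \<delta> * 1"
      using F(3) y1 \<delta>(1) by (intro mult_mono) (auto simp: dist_real_def)
    finally have "Re (cinner y (T y)) \<le> \<delta>" by simp
    then have "Re t * Re (cinner y (T y)) \<le> (\<epsilon> / 4)\<^sup>2"
      using \<delta>(2) t0 by (meson mult_left_mono order_trans)
    moreover have "(norm (T y))\<^sup>2 \<le> Re t * Re (cinner y (T y))"
      by (rule positive_op_norm_le[OF T(1) positive_trace_bound[OF T]])
    ultimately have "(norm (T y))\<^sup>2 \<le> (\<epsilon> / 4)\<^sup>2" by linarith
    then have Ty: "norm (T y) \<le> \<epsilon> / 4"
      by (rule power2_le_imp_le) (use \<open>0 < \<epsilon>\<close> in simp)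
    have "cmod (cinner f x) \<le> 1" if "f \<in> F" for f
      using cinner_Cauchy_Schwarz[of f x] onF that x by (auto simp: orthonormal_set_def)
    then have "(\<Sum>f\<in>F. cinner f x *\<^sub>C T f) \<in> ?K"
      by (auto intro!: exI[of _ "\<lambda>f. cinner f x"])
    moreover have "(\<Sum>f\<in>F. cinner f x *\<^sub>C T f) = T ?s"
      by (simp add: clinear_sum[OF lin] clinear_scaleC[OF lin])
    ultimately obtain u where u: "u \<in> k" "dist u (T ?s) < \<epsilon> / 4"
      using k by auto
    have "T x = T ?s + T y"
      by (simp add: y_def flip: clinear_add[OF lin])
    then have "dist u (T x) \<le> \<epsilon> / 2"
      using u(2) Ty dist_triangle[of u "T x" "T ?s"] by (simp add: dist_norm)
    then show "z \<in> (\<Union>x\<in>k. cball x (\<epsilon> / 2))" using u x by auto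
  qed
  \<comment> \<open>A finite union of closed balls is closed, so the cover passes to the closure;
    the slack from \<open>\<epsilon> / 2\<close> to \<open>\<epsilon>\<close> restores open
    balls.\<close>
  then have "closure (T ` cball 0 1) \<subseteq> (\<Union>x\<in>k. cball x (\<epsilon> / 2))"
    using k(1) by (intro closure_minimal closed_UN) auto
  also have "\<dots> \<subseteq> (\<Union>x\<in>k. ball x \<epsilon>)"
    using \<open>0 < \<epsilon>\<close> by (intro UN_mono) auto
  finally show "\<exists>k. finite k \<and> closure (T ` cball 0 1) \<subseteq> (\<Union>x\<in>k. ball x \<epsilon>)"
    using k(1) by blast
qed

lemma norm_diff_sq:
  fixes x y :: "'a::complex_inner"
  shows "(norm (x - y))\<^sup>2 = (norm x)\<^sup>2 - 2 * Re (cinner y x) + (norm y)\<^sup>2"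
  using cinner_commute[of x y]
  by (simp add: cinner_diff_left cinner_diff_right flip: Re_cinner_self)

text \<open>The supremum \<open>l\<close> of the quadratic form \<open>q\<close> on the unit vectors
  of \<open>V\<close> is attained. A maximizing sequence is asymptotically an eigenvector sequence
  for \<open>l\<close>, and compactness of \<open>T\<close> together with \<open>l > 0\<close> makes
  a subsequence converge.\<close>

lemma positive_trace_eigenvector:
  fixes T :: "'h::chilbert_space \<Rightarrow> 'h"
  assumes T: "positive_op T" "has_trace T t"
    and V: "closed V" "\<And>x. x \<in> V \<Longrightarrow> T x \<in> V" "\<And>x r. x \<in> V \<Longrightarrow> r *\<^sub>R x \<in> V"
    and v: "v \<in> V" "T v \<noteq> 0"
  obtains x l where "x \<in> V" "norm x = 1" "0 < l" "T x = l *\<^sub>R x"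
proof -
  note lin = positive_op_clinear[OF T(1)]
  note nn = positive_op_nonneg[OF T(1)]
  define U where "U = {x\<in>V. norm x = 1}"
  define q where "q x = Re (cinner x (T x))" for x
  have bdd: "bdd_above (q ` U)"
  proof (rule bdd_aboveI2)
    fix x assume "x \<in> U"
    then show "q x \<le> Re t"
      using positive_trace_bound[OF T, of x] by (simp add: q_def U_def)
  qed
  define l where "l = Sup (q ` U)"
  have norm_V: "\<exists>u\<in>U. q y = q u * (norm y)\<^sup>2" if "y \<in> V" "y \<noteq> 0" for y
    using that V(3)[of y "1 / norm y"] Re_cinner_scaleR[OF lin, of "1 / norm y" y]
    by (intro bexI[of _ "(1 / norm y) *\<^sub>R y"]) (auto simp: U_def q_def field_simps)
  have q_le: "q y \<le> l * (norm y)\<^sup>2" if y: "y \<in> V" for y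
  proof (cases "y = 0")
    case False
    then obtain u where "u \<in> U" "q y = q u * (norm y)\<^sup>2" using norm_V y by blast
    moreover have "q u \<le> l" unfolding l_def using \<open>u \<in> U\<close> bdd by (intro cSup_upper) auto
    ultimately show ?thesis by (simp add: mult_right_mono)
  qed (simp add: q_def clinear_zero[OF lin])
  have "v \<noteq> 0" using v clinear_zero[OF lin] by auto
  then have "U \<noteq> {}" using norm_V v by blast
  \<comment> \<open>Positivity of \<open>l\<close>: the norm bound shows that
    \<open>T v \<noteq> 0\<close> forces \<open>q v > 0\<close>.\<close>
  have "0 < (norm (T v))\<^sup>2" using v by simp
  also have "(norm (T v))\<^sup>2 \<le> Re t * q v"
    unfolding q_def by (rule positive_op_norm_le[OF T(1) positive_trace_bound[OF T]])
  finally have "0 < q v" using nn[of v] by (cases "q v = 0") (auto simp: q_def)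
  then have l: "0 < l"
    using q_le[OF v(1)] by (metis mult_nonpos_nonneg not_le order_trans zero_le_power2)
  have "\<exists>x\<in>U. l - inverse (real (Suc n)) < q x" for n
    using less_cSup_iff[of "q ` U" "l - inverse (real (Suc n))"] bdd \<open>U \<noteq> {}\<close> by (auto simp: l_def)
  then obtain x where x: "\<And>n. x n \<in> U" "\<And>n. l - inverse (real (Suc n)) < q (x n)"
    by metis
  have "(norm (T (x n) - l *\<^sub>R x n))\<^sup>2 \<le> l * inverse (real (Suc n))" for n
  proof -
    have xn: "x n \<in> V" "norm (x n) = 1" using x(1)[of n] by (auto simp: U_def)
    \<comment> \<open>Invariance of \<open>V\<close> puts \<open>T (x n)\<close> into
      \<open>V\<close>, where \<open>l\<close> bounds the form. Expanding the square then leaves at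
      most \<open>l * (l - q (x n))\<close>.\<close>
    have "(norm (T (x n)))\<^sup>2 \<le> l * q (x n)"
      unfolding q_def
      by (rule positive_op_norm_le[OF T(1)]) (use q_le[OF V(2)[OF xn(1)]] in \<open>simp add: q_def\<close>)
    moreover have "(norm (T (x n) - l *\<^sub>R x n))\<^sup>2 = (norm (T (x n)))\<^sup>2 - 2 * (l * q (x n)) + l * l"
      using norm_diff_sq[of "T (x n)" "l *\<^sub>R x n"] xn
      by (simp add: q_def cinner_scaleR_left power_mult_distrib power2_eq_square)
    ultimately have "(norm (T (x n) - l *\<^sub>R x n))\<^sup>2 \<le> l * (l - q (x n))"
      by (simp add: right_diff_distrib)
    also have "\<dots> \<le> l * inverse (real (Suc n))"
      using x(2)[of n] l by (intro mult_left_mono) auto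
    finally show ?thesis .
  qed
  then have "norm (T (x n) - l *\<^sub>R x n) \<le> sqrt (l * inverse (real (Suc n)))" for n
    by (simp only: real_le_rsqrt)
  moreover have "(\<lambda>n. sqrt (l * inverse (real (Suc n)))) \<longlonglongrightarrow> sqrt (l * 0)"
    by (intro tendsto_intros LIMSEQ_inverse_real_of_nat)
  ultimately have diff: "(\<lambda>n. T (x n) - l *\<^sub>R x n) \<longlonglongrightarrow> 0"
    using Lim_null_comparison[of "\<lambda>n. T (x n) - l *\<^sub>R x n" "\<lambda>n. sqrt (l * inverse (real (Suc n)))" sequentially]
    by (simp only: mult_zero_right real_sqrt_zero eventually_True)
  have "T (x n) \<in> closure (T ` cball 0 1)" for n
    using x(1)[of n] by (intro subsetD[OF closure_subset]) (auto simp: U_def)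
  then obtain y r where y: "strict_mono r" "((\<lambda>n. T (x n)) \<circ> r) \<longlonglongrightarrow> y"
    using compact_closure_positive_trace[OF T] unfolding compact_def by metis
  \<comment> \<open>The expression is \<open>x (r n)\<close> itself, written through two sequences
    known to converge.\<close>
  have "(\<lambda>n. (1 / l) *\<^sub>R (T (x (r n)) - (T (x (r n)) - l *\<^sub>R x (r n)))) \<longlonglongrightarrow> (1 / l) *\<^sub>R (y - 0)"
    using y(2) LIMSEQ_subseq_LIMSEQ[OF diff y(1)] by (intro tendsto_intros) (simp_all add: o_def)
  moreover define z where "z = (1 / l) *\<^sub>R y"
  ultimately have lim: "(\<lambda>n. x (r n)) \<longlonglongrightarrow> z" using l by simp
  have "z \<in> V"
    using closed_sequentially[OF V(1) _ lim] x(1) by (simp add: U_def)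
  moreover have "norm z = 1"
    using tendsto_norm[OF lim] x(1) by (simp add: U_def LIMSEQ_const_iff)
  moreover have "(\<lambda>n. T (x (r n))) \<longlonglongrightarrow> T z"
    by (rule bounded_linear.tendsto[OF clinear_bounded_linear[OF lin] lim])
  then have "T z = y" using y(2) LIMSEQ_unique by (auto simp: o_def)
  then have "T z = l *\<^sub>R z" using l by (simp add: z_def)
  ultimately show ?thesis using that l by blast
qed

text \<open>A maximal orthonormal set \<open>S\<close> of eigenvectors with positive eigenvalue is
  completed to a basis. The orthogonal complement of \<open>S\<close> is closed and invariant, so if
  \<open>T\<close> did not vanish on it there would be a further such eigenvector. The added basis
  vectors therefore have eigenvalue 0.\<close>

lemma positive_trace_diagonalizable:
  fixes T :: "'h::chilbert_space \<Rightarrow> 'h"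
  assumes T: "positive_op T" "has_trace T t"
  obtains E where "orthonormal_basis E" "\<And>e. e \<in> E \<Longrightarrow> T e = Re (cinner e (T e)) *\<^sub>R e"
proof -
  define V where "V = {x. \<exists>l>0. T x = l *\<^sub>R x}"
  obtain S where S: "S \<subseteq> V" "orthonormal_set S"
    and max: "\<And>x. x \<in> V \<Longrightarrow> norm x = 1 \<Longrightarrow> \<exists>s\<in>S. cinner s x \<noteq> 0"
    using extend_orthonormal_set[of "{}" V] by (auto simp: orthonormal_set_def)
  obtain E where E: "S \<subseteq> E" "orthonormal_basis E"
    using extend_orthonormal_basis[OF S(2)] by blast
  define W where "W = (\<Inter>s\<in>S. {x. cinner s x = 0})"
  have "T e = Re (cinner e (T e)) *\<^sub>R e" if "e \<in> E" for e
  proof (cases "e \<in> S")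
    case True
    then obtain l where "T e = l *\<^sub>R e"
      using S(1) by (auto simp: V_def)
    moreover have "norm e = 1"
      using S(2) True by (simp add: orthonormal_set_def)
    ultimately show ?thesis by (simp add: cinner_scaleR_right cinner_self)
  next
    case False
    have "T e = 0"
    proof (rule ccontr)
      assume "T e \<noteq> 0"
      have eW: "e \<in> W"
        using E S False that by (auto simp: W_def orthonormal_basis_iff orthonormal_set_def)
      have "closed W"
        unfolding W_def
        by (intro closed_INT ballI closed_Collect_eq linear_continuous_on
            bounded_linear_cinner_right continuous_on_const)
      moreover have "T x \<in> W" if "x \<in> W" for x
        unfolding W_def
      proof (intro INT_I CollectI)
        fix s assume "s \<in> S"
        then obtain l where "T s = l *\<^sub>R s" using S by (auto simp: V_def)
        then show "cinner s (T x) = 0"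
          using positive_op_symmetric[OF T(1), of s x] \<open>s \<in> S\<close> that
          by (simp add: cinner_scaleR_left W_def)
      qed
      moreover have "r *\<^sub>R x \<in> W" if "x \<in> W" for x r
        using that by (simp add: W_def cinner_scaleR_right)
      ultimately obtain x l where "x \<in> W" "norm x = 1" "0 < l" "T x = l *\<^sub>R x"
        using positive_trace_eigenvector[OF T, of W e] eW \<open>T e \<noteq> 0\<close> by blast
      then show False
        using max[of x] by (auto simp: V_def W_def)
    qed
    then show ?thesis by simp
  qed
  then show ?thesis using that E by blast
qed

text \<open>Basis independence of the trace of \<open>B \<circ> T\<close> by Fubini: the double
  family \<open>p e * cinner f (B e) * cinner e f\<close> over the eigenbasis \<open>E\<close> and
  any basis \<open>E'\<close> is absolutely summable, and its two iterated sums are the two diagonal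
  sums.\<close>

lemma trace_op_diagonal:
  fixes T B :: "'h::chilbert_space \<Rightarrow> 'h"
  assumes T: "positive_op T" "has_trace T t" and B: "bounded_clinear B"
    and E: "orthonormal_basis E" and diag: "\<And>e. e \<in> E \<Longrightarrow> T e = p e *\<^sub>R e"
  obtains s where "((\<lambda>e. p e * cinner e (B e)) has_sum s) E" "has_trace (B \<circ> T) s"
proof -
  have on: "orthonormal_set E" using E by (simp add: orthonormal_basis_iff)
  have p: "p e = Re (cinner e (T e))" if "e \<in> E" for e
    using diag[OF that] on that by (simp add: cinner_scaleR_right orthonormal_setD)
  have p0: "0 \<le> p e" if "e \<in> E" for e
    using p[OF that] positive_op_nonneg[OF T(1)] by simp
  have "((\<lambda>e. Re (cinner e (T e))) has_sum Re t) E"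
    using T(2) E by (intro has_sum_Re) (simp add: has_trace_def)
  then have psum: "p summable_on E"
    by (metis (mono_tags, lifting) p has_sum_cong summable_on_def)
  obtain K where K: "\<And>x. norm (B x) \<le> norm x * K"
    using B bounded_linear.bounded unfolding bounded_clinear_def by blast
  \<comment> \<open>A bound uniform in \<open>e\<close>, from the arithmetic-geometric mean
    inequality and Bessel for \<open>e\<close> and \<open>B e\<close>. Summability of
    \<open>p\<close> then controls the double sum.\<close>
  have sum_le: "(\<lambda>f. norm (cinner f (B e) * cinner e f)) summable_on E'"
    "(\<Sum>\<^sub>\<infinity>f\<in>E'. norm (cinner f (B e) * cinner e f)) \<le> (1/2) * (1 + K\<^sup>2)"
    if "e \<in> E" and E': "orthonormal_basis E'" for e E'
  proof -
    have on': "orthonormal_set E'" using E' by (simp add: orthonormal_basis_iff)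
    have e1: "norm e = 1" using on that by (simp add: orthonormal_set_def)
    have am: "norm (cinner f (B e) * cinner e f) \<le> (1/2) * ((cmod (cinner f e))\<^sup>2 + (cmod (cinner f (B e)))\<^sup>2)" for f
    proof -
      have "cmod (cinner e f) = cmod (cinner f e)"
        by (metis cinner_commute complex_mod_cnj)
      then show ?thesis
        using sum_squares_bound[of "cmod (cinner f e)" "cmod (cinner f (B e))"] by (simp add: norm_mult mult_ac)
    qed
    have S: "(\<lambda>f. (1/2) * ((cmod (cinner f e))\<^sup>2 + (cmod (cinner f (B e)))\<^sup>2)) summable_on E'"
      by (intro summable_on_cmult_right summable_on_add Bessel_summable[OF on'])
    show 1: "(\<lambda>f. norm (cinner f (B e) * cinner e f)) summable_on E'"
      by (rule summable_on_comparison_test[OF S]) (use am in auto)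
    have "(\<Sum>\<^sub>\<infinity>f\<in>E'. norm (cinner f (B e) * cinner e f))
      \<le> (\<Sum>\<^sub>\<infinity>f\<in>E'. (1/2) * ((cmod (cinner f e))\<^sup>2 + (cmod (cinner f (B e)))\<^sup>2))"
      by (rule infsum_mono[OF 1 S am])
    also have "\<dots> = (1/2) * ((\<Sum>\<^sub>\<infinity>f\<in>E'. (cmod (cinner f e))\<^sup>2) + (\<Sum>\<^sub>\<infinity>f\<in>E'. (cmod (cinner f (B e)))\<^sup>2))"
      by (subst infsum_cmult_right', subst infsum_add) (simp_all add: Bessel_summable[OF on'])
    also have "\<dots> \<le> (1/2) * ((norm e)\<^sup>2 + (norm (B e))\<^sup>2)"
      by (intro mult_left_mono add_mono Bessel_summable[OF on']) auto
    also have "\<dots> \<le> (1/2) * (1 + K\<^sup>2)"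
      using K[of e] e1 by (intro mult_left_mono add_mono power_mono) auto
    finally show "(\<Sum>\<^sub>\<infinity>f\<in>E'. norm (cinner f (B e) * cinner e f)) \<le> (1/2) * (1 + K\<^sup>2)" .
  qed
  define s where "s = (\<Sum>\<^sub>\<infinity>e\<in>E. p e * cinner e (B e))"
  have hs: "((\<lambda>e. p e * cinner e (B e)) has_sum s) E"
    unfolding s_def
  proof (rule has_sum_infsum, rule abs_summable_summable)
    show "(\<lambda>e. norm (complex_of_real (p e) * cinner e (B e))) summable_on E"
    proof (rule summable_on_comparison_test[OF summable_on_cmult_left[OF psum]])
      fix e assume e: "e \<in> E"
      then have "norm e = 1" using on by (simp add: orthonormal_set_def)
      then have "cmod (cinner e (B e)) \<le> K"
        using cinner_Cauchy_Schwarz[of e "B e"] K[of e] by simp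
      then show "norm (complex_of_real (p e) * cinner e (B e)) \<le> p e * K"
        using p0[OF e] by (simp add: norm_mult mult_left_mono)
    qed auto
  qed
  have "((\<lambda>f. cinner f ((B \<circ> T) f)) has_sum s) E'" if E': "orthonormal_basis E'" for E'
  proof -
    let ?g = "\<lambda>(e, f). complex_of_real (p e) * (cinner f (B e) * cinner e f)"
    have "(\<lambda>x. norm (?g x)) summable_on E \<times> E'"
      unfolding Infinite_Sum.abs_summable_on_Sigma_iff
    proof (intro conjI ballI)
      fix e assume "e \<in> E"
      then show "(\<lambda>f. norm (?g (e, f))) summable_on E'"
        using sum_le(1)[OF _ E'] by (auto simp: norm_mult intro!: summable_on_cmult_right)
    next
      have "(\<lambda>e. norm (\<Sum>\<^sub>\<infinity>f\<in>E'. norm (?g (e, f)))) summable_on E"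
      proof (rule summable_on_comparison_test[OF summable_on_cmult_left[OF psum]])
        fix e assume e: "e \<in> E"
        have "(\<Sum>\<^sub>\<infinity>f\<in>E'. norm (?g (e, f))) = p e * (\<Sum>\<^sub>\<infinity>f\<in>E'. norm (cinner f (B e) * cinner e f))"
          using p0[OF e] by (simp add: norm_mult infsum_cmult_right')
        also have "\<dots> \<le> p e * ((1/2) * (1 + K\<^sup>2))"
          using sum_le(2)[OF e E'] p0[OF e] by (rule mult_left_mono)
        finally show "norm (\<Sum>\<^sub>\<infinity>f\<in>E'. norm (?g (e, f))) \<le> p e * ((1/2) * (1 + K\<^sup>2))"
          by (simp add: infsum_nonneg)
      qed auto
      then show "(\<lambda>e. norm (\<Sum>\<^sub>\<infinity>f\<in>E'. norm (?g (e, f)))) summable_on E" .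
    qed
    then have "?g summable_on E \<times> E'"
      by (rule abs_summable_summable)
    \<comment> \<open>Summing over \<open>f\<close> first, Parseval in \<open>E'\<close> gives
      \<open>p e * cinner e (B e)\<close>.\<close>
    then have "(?g has_sum s) (E \<times> E')"
      by (rule has_sum_SigmaI[rotated 2])
        (use hs Parseval[OF E'] in \<open>auto intro!: has_sum_cmult_right simp: mult.commute\<close>)
    then have "((\<lambda>(f, e). ?g (e, f)) has_sum s) (E' \<times> E)"
      by (subst (asm) has_sum_swap)
    \<comment> \<open>Summing over \<open>e\<close> first, expanding \<open>T f\<close> in
      \<open>E\<close> gives \<open>cinner f (B (T f))\<close>.\<close>
    then show ?thesis
    proof (rule has_sum_SigmaD)
      fix f assume "f \<in> E'"
      have "bounded_linear (\<lambda>x. cinner f (B x))"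
        by (rule bounded_linear_compose[OF bounded_linear_cinner_right clinear_bounded_linear[OF B]])
      from has_sum_bounded_linear[OF this orthonormal_expansion[OF E]]
      have "((\<lambda>e. cinner e (T f) * cinner f (B e)) has_sum cinner f (B (T f))) E"
        by (simp add: clinear_scaleC[OF B] cinner_scaleC_right)
      moreover have "cinner e (T f) = p e * cinner e f" if "e \<in> E" for e
        using positive_op_symmetric[OF T(1), of e f] diag[OF that] by (simp add: cinner_scaleR_left)
      ultimately show "((\<lambda>e. case (f, e) of (f, e) \<Rightarrow> ?g (e, f)) has_sum cinner f ((B \<circ> T) f)) E"
        by (subst (asm) has_sum_cong[where g = "\<lambda>e. p e * cinner e f * cinner f (B e)"])
          (auto simp: mult_ac)
    qed
  qed
  then have "has_trace (B \<circ> T) s" by (simp add: has_trace_def)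
  with hs show ?thesis by (rule that)
qed

subsection \<open>Logarithmic derivatives\<close>

text \<open>Derivatives are local. Identities such as unit trace and unbiasedness are known only on
  the open parameter domain.\<close>

lemma wirtinger_cong:
  assumes "f differentiable (at \<alpha>)" "open X" "\<alpha> \<in> X" "\<And>\<beta>. \<beta> \<in> X \<Longrightarrow> f \<beta> = g \<beta>"
  shows "wirtinger k g \<alpha> = wirtinger k f \<alpha>"
  unfolding wirtinger_def using frechet_derivative_transform_within_open[OF assms] by simp

lemma wirtinger_const: "wirtinger k (\<lambda>_. c) \<alpha> = 0"
  by (simp add: wirtinger_def)

text \<open>Differentiating \<open>cinner \<psi> (\<rho> \<beta> \<phi>) = cinner (\<rho> \<beta>
  \<psi>) \<phi>\<close> in real directions; conjugate-linearity in the first argument flips the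
  sign of \<i> and exchanges the two Wirtinger derivatives.\<close>

lemma cinner_op_wirtinger_bar:
  fixes \<rho> :: "complex^'n \<Rightarrow> 'h::chilbert_space \<Rightarrow> 'h"
  assumes X: "open X" "\<alpha> \<in> X" and pos: "\<And>\<beta>. \<beta> \<in> X \<Longrightarrow> positive_op (\<rho> \<beta>)"
    and diff: "\<And>\<phi>. (\<lambda>\<beta>. \<rho> \<beta> \<phi>) differentiable (at \<alpha>)"
  shows "cinner \<psi> (op_wirtinger_bar k \<rho> \<alpha> \<phi>) = cinner (op_wirtinger k \<rho> \<alpha> \<psi>) \<phi>"
proof -
  let ?F = "\<lambda>\<phi>. frechet_derivative (\<lambda>\<beta>. \<rho> \<beta> \<phi>) (at \<alpha>)"
  have F: "((\<lambda>\<beta>. \<rho> \<beta> \<phi>) has_derivative ?F \<phi>) (at \<alpha>)" for \<phi>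
    using diff frechet_derivative_works by blast
  have "((\<lambda>\<beta>. cinner \<psi> (\<rho> \<beta> \<phi>)) has_derivative (\<lambda>v. cinner \<psi> (?F \<phi> v))) (at \<alpha>)"
    by (rule bounded_linear.has_derivative[OF bounded_linear_cinner_right F])
  moreover have "((\<lambda>\<beta>. cinner (\<rho> \<beta> \<psi>) \<phi>) has_derivative (\<lambda>v. cinner (?F \<psi> v) \<phi>)) (at \<alpha>)"
    by (rule bounded_linear.has_derivative[OF bounded_linear_cinner_left F])
  then have "((\<lambda>\<beta>. cinner \<psi> (\<rho> \<beta> \<phi>)) has_derivative (\<lambda>v. cinner (?F \<psi> v) \<phi>)) (at \<alpha>)"
    by (rule has_derivative_transform_within_open[OF _ X]) (simp add: positive_op_symmetric[OF pos])
  ultimately have "(\<lambda>v. cinner \<psi> (?F \<phi> v)) = (\<lambda>v. cinner (?F \<psi> v) \<phi>)"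
    by (rule has_derivative_unique)
  then have "cinner \<psi> (?F \<phi> v) = cinner (?F \<psi> v) \<phi>" for v
    by (rule fun_cong)
  then show ?thesis
    by (simp add: op_wirtinger_bar_def op_wirtinger_def wirtinger_def wirtinger_bar_def
        cinner_scaleC_left cinner_scaleC_right cinner_add_right cinner_diff_left algebra_simps)
qed

text \<open>\<^term>\<open>D\<close> plays the role of \<open>h\<^sub>l\<^sup>* \<rho>\<close>.\<close>

lemma info_op_eq:
  assumes dense: "closure (dom hl) = UNIV"
    and D: "\<And>\<psi> \<phi>. \<phi> \<in> dom hl \<Longrightarrow> cinner (\<rho> \<psi>) (the (hl \<phi>)) = cinner (D \<psi>) \<phi>"
  shows "info_op hk hl \<rho> \<psi> = hk (D \<psi>)"
proof -
  have "(THE \<xi>. \<forall>\<phi>\<in>dom hl. cinner (\<rho> \<psi>) (the (hl \<phi>)) = cinner \<xi> \<phi>) = D \<psi>"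
  proof (rule the_equality)
    fix \<xi> assume "\<forall>\<phi>\<in>dom hl. cinner (\<rho> \<psi>) (the (hl \<phi>)) = cinner \<xi> \<phi>"
    then show "\<xi> = D \<psi>"
      using D by (intro cinner_eq_on_dense[OF dense]) metis
  qed (use D in blast)
  moreover have "\<exists>\<xi>. \<forall>\<phi>\<in>dom hl. cinner (\<rho> \<psi>) (the (hl \<phi>)) = cinner \<xi> \<phi>"
    using D by blast
  ultimately have "op_adj hl (\<rho> \<psi>) = Some (D \<psi>)"
    unfolding op_adj_def by simp
  then show ?thesis
    by (simp add: info_op_def map_comp_def)
qed

text \<open>At an eigenvector with eigenvalue \<open>r\<close>, the vector
  \<open>(1 / r) *\<^sub>R Dk e\<close> stands for the adjoint of \<open>hk\<close> applied to
  \<open>e\<close>. For \<open>r = 0\<close> density of the domains gives \<open>Dk e = 0\<close>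
  and \<open>Dl e = 0\<close>, consistent with \<open>1 / 0 = 0\<close>.\<close>

lemma info_op_eigenvector:
  assumes hk: "densely_defined_op hk" and hl: "densely_defined_op hl"
    and Dk: "\<And>\<psi> \<phi>. \<phi> \<in> dom hk \<Longrightarrow> cinner (\<rho> \<psi>) (the (hk \<phi>)) = cinner (Dk \<psi>) \<phi>"
    and Dl: "\<And>\<psi> \<phi>. \<phi> \<in> dom hl \<Longrightarrow> cinner (\<rho> \<psi>) (the (hl \<phi>)) = cinner (Dl \<psi>) \<phi>"
    and "info_op hk hl \<rho> e \<noteq> None"
    and e: "\<rho> e = r *\<^sub>R e"
  shows "cinner e (the (info_op hk hl \<rho> e))
    = r * cinner ((1 / r) *\<^sub>R Dk e) ((1 / r) *\<^sub>R Dl e)" (is ?A)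
    and "Dk e = r *\<^sub>R (1 / r) *\<^sub>R Dk e" (is ?B)
proof -
  have dense: "closure (dom hk) = UNIV" "closure (dom hl) = UNIV"
    using hk hl by (auto simp: densely_defined_op_def)
  have zero: "Dk e = 0" if "r = 0"
    by (rule cinner_eq_on_dense[OF dense(1)]) (use Dk[of _ e] e that in simp)
  have zero': "Dl e = 0" if "r = 0"
    by (rule cinner_eq_on_dense[OF dense(2)]) (use Dl[of _ e] e that in simp)
  show ?B using zero by auto
  have info: "info_op hk hl \<rho> e = hk (Dl e)"
    by (rule info_op_eq[OF dense(2) Dl])
  then have dom: "Dl e \<in> dom hk" using assms(5) by auto
  show ?A
  proof (cases "r = 0")
    case True
    \<comment> \<open>Since \<open>Dl e = 0\<close>, homogeneity yields
      \<open>hk 0 = Some 0\<close>, so the matrix element vanishes.\<close>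
    have "hk (0 *\<^sub>C Dl e) = Some (0 *\<^sub>C the (hk (Dl e)))"
      using hk dom unfolding densely_defined_op_def by blast
    then show ?thesis using info True zero' by simp
  next
    case False
    \<comment> \<open>The adjoint relation for \<open>hk\<close> at \<open>Dl e\<close>, which lies
      in its domain because \<open>info_op\<close> is defined at \<open>e\<close>.\<close>
    have "r * cinner e (the (hk (Dl e))) = cinner (Dk e) (Dl e)"
      using Dk[OF dom, of e] e by (simp add: cinner_scaleR_left)
    then show ?thesis
      using False info by (simp add: cinner_scaleR_left cinner_scaleR_right field_simps)
  qed
qed

subsection \<open>Outcome distributions\<close>

lemma qpm_positive: "qpm M P \<Longrightarrow> B \<in> sets M \<Longrightarrow> positive_op (P B)"
  by (simp add: qpm_def)

lemma qpm_space: "qpm M P \<Longrightarrow> P (space M) x = x"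
  by (simp add: qpm_def)

lemma qpm_sums:
  assumes "qpm M P" "range A \<subseteq> sets M" "disjoint_family A"
  shows "(\<lambda>n. cinner \<psi> (P (A n) \<phi>)) sums cinner \<psi> (P (\<Union>n. A n) \<phi>)"
  using assms by (simp add: qpm_def)

text \<open>Additivity on the constant sequence of empty sets: a constant series converges only if
  its term is 0.\<close>

lemma qpm_empty:
  assumes "qpm M P"
  shows "cinner \<psi> (P {} \<phi>) = 0"
proof -
  have "(\<lambda>n::nat. cinner \<psi> (P {} \<phi>)) sums cinner \<psi> (P {} \<phi>)"
    using qpm_sums[OF assms, of "\<lambda>_. {}"] by (simp add: disjoint_family_on_def)
  then show ?thesis
    using sums_summable summable_const_iff by blast
qed

lemma qpm_Un:
  assumes "qpm M P" "A \<in> sets M" "B \<in> sets M" "A \<inter> B = {}"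
  shows "cinner \<psi> (P (A \<union> B) \<phi>) = cinner \<psi> (P A \<phi>) + cinner \<psi> (P B \<phi>)"
proof -
  have "(\<lambda>n. cinner \<psi> (P (binaryset A B n) \<phi>)) sums cinner \<psi> (P (\<Union>n. binaryset A B n) \<phi>)"
    using assms by (intro qpm_sums)
      (auto simp: range_binaryset_eq disjoint_family_on_def binaryset_def)
  then show ?thesis
    using binaryset_sums[of "\<lambda>A. cinner \<psi> (P A \<phi>)" A B] qpm_empty[OF assms(1)] sums_unique2
    by (simp add: UN_binaryset_eq) blast
qed

lemma qpm_finite_Union:
  assumes "qpm M P" "finite Y" "\<And>y. y \<in> Y \<Longrightarrow> A y \<in> sets M" "disjoint_family_on A Y"
  shows "cinner \<psi> (P (\<Union>y\<in>Y. A y) \<phi>) = (\<Sum>y\<in>Y. cinner \<psi> (P (A y) \<phi>))"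
  using assms(2-)
proof (induction Y rule: finite_induct)
  case (insert a Y)
  have "A a \<inter> (\<Union>y\<in>Y. A y) = {}"
    using insert by (auto simp: disjoint_family_on_def)
  then have "cinner \<psi> (P (A a \<union> (\<Union>y\<in>Y. A y)) \<phi>) = cinner \<psi> (P (A a) \<phi>) + cinner \<psi> (P (\<Union>y\<in>Y. A y) \<phi>)"
    using insert by (intro qpm_Un[OF assms(1)]) auto
  then show ?case using insert by (simp add: disjoint_family_on_def)
qed (simp add: qpm_empty[OF assms(1)])

lemma sets_outcome_distr: "sets (outcome_distr M P \<rho>) = sets M"
  by (simp add: outcome_distr_def)

text \<open>In the eigenbasis the distribution is a sum of nonnegative terms, so countable
  additivity is an interchange of nonnegative sums. This certifies that \<open>measure_of\<close>
  really yields the given set function.\<close>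

lemma outcome_distr_diagonal:
  fixes \<rho> :: "'h::chilbert_space \<Rightarrow> 'h"
  assumes P: "qpm M P" and \<rho>: "positive_op \<rho>" "has_trace \<rho> t"
    and E: "orthonormal_basis E" and diag: "\<And>e. e \<in> E \<Longrightarrow> \<rho> e = p e *\<^sub>R e"
    and p: "\<And>e. e \<in> E \<Longrightarrow> 0 \<le> p e"
  shows "finite_measure (outcome_distr M P \<rho>)"
    and "B \<in> sets M \<Longrightarrow> ((\<lambda>e. p e * Re (cinner e (P B e))) has_sum measure (outcome_distr M P \<rho>) B) E"
proof -
  define m where "m B = Re (Tr (P B \<circ> \<rho>))" for B
  let ?f = "\<lambda>B e. p e * Re (cinner e (P B e))"
  have hs: "(?f B has_sum m B) E" if B: "B \<in> sets M" for B
  proof -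
    obtain s where s: "((\<lambda>e. p e * cinner e (P B e)) has_sum s) E" "has_trace (P B \<circ> \<rho>) s"
      using trace_op_diagonal[OF \<rho> positive_op_clinear[OF qpm_positive[OF P B]] E diag] by blast
    from has_sum_Re[OF s(1)] show ?thesis
      by (simp add: m_def Tr_eqI[OF s(2)])
  qed
  have nn: "0 \<le> ?f B e" if "B \<in> sets M" "e \<in> E" for B e
    using that p positive_op_nonneg[OF qpm_positive[OF P that(1)]] by simp
  have m0: "0 \<le> m B" if "B \<in> sets M" for B
    using hs[OF that] nn[OF that] by (rule has_sum_nonneg)
  have add: "(\<lambda>n. m (A n)) sums m (\<Union>n. A n)"
    if A: "range A \<subseteq> sets M" "disjoint_family A" for A :: "nat \<Rightarrow> _"
  proof -
    have An: "A n \<in> sets M" for n using A by auto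
    have UA: "(\<Union>n. A n) \<in> sets M" using An by auto
    have 1: "((\<lambda>n. ?f (A n) e) has_sum ?f (\<Union>n. A n) e) UNIV" if "e \<in> E" for e
      using nn An that
      by (intro sums_nonneg_imp_has_sum sums_mult sums_Re qpm_sums[OF P A]) auto
    have "(\<lambda>(e, n). ?f (A n) e) summable_on E \<times> UNIV"
      by (rule summable_on_SigmaI[where g = "?f (\<Union>n. A n)"])
        (use 1 nn An hs[OF UA] in \<open>auto simp: summable_on_def\<close>)
    then have "((\<lambda>(e, n). ?f (A n) e) has_sum m (\<Union>n. A n)) (E \<times> UNIV)"
      by (rule has_sum_SigmaI[where g = "?f (\<Union>n. A n)", rotated 2]) (use 1 hs[OF UA] in auto)
    then have "((\<lambda>(n, e). ?f (A n) e) has_sum m (\<Union>n. A n)) (UNIV \<times> E)"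
      by (subst (asm) has_sum_swap) simp
    then have "((\<lambda>n. m (A n)) has_sum m (\<Union>n. A n)) UNIV"
      by (rule has_sum_SigmaD) (use hs[OF An] in auto)
    then show ?thesis by (rule has_sum_imp_sums)
  qed
  have m_empty: "m {} = 0"
    using hs[of "{}"] by (auto simp: qpm_empty[OF P] dest: has_sum_unique[OF has_sum_0_simp])
  note sets = sets_outcome_distr[of M P \<rho>]
  have distr: "outcome_distr M P \<rho> = measure_of (space M) (sets M) (\<lambda>B. ennreal (m B))"
    by (simp add: outcome_distr_def m_def)
  have em: "emeasure (outcome_distr M P \<rho>) B = ennreal (m B)" if "B \<in> sets M" for B
  proof (rule emeasure_measure_of[OF distr])
    show "sets M \<subseteq> Pow (space M)" by (rule sets.space_closed)
    show "positive (sets (outcome_distr M P \<rho>)) (\<lambda>B. ennreal (m B))"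
      by (simp add: positive_def m_empty)
    show "countably_additive (sets (outcome_distr M P \<rho>)) (\<lambda>B. ennreal (m B))"
      unfolding sets countably_additive_def
    proof (intro allI impI)
      fix A :: "nat \<Rightarrow> _" assume A: "range A \<subseteq> sets M" "disjoint_family A"
      then show "(\<Sum>n. ennreal (m (A n))) = ennreal (m (\<Union>n. A n))"
        by (intro suminf_ennreal_eq add m0) auto
    qed
    show "B \<in> sets (outcome_distr M P \<rho>)" using that sets by simp
  qed
  show "finite_measure (outcome_distr M P \<rho>)"
    by (rule finite_measureI) (simp add: sets_eq_imp_space_eq[OF sets] em)
  show "(?f B has_sum measure (outcome_distr M P \<rho>) B) E" if "B \<in> sets M"
    using hs[OF that] em[OF that] m0[OF that] by (simp add: measure_def)
qed

lemma has_sum_sum: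
  fixes f :: "'i \<Rightarrow> 'a \<Rightarrow> 'b::topological_comm_monoid_add"
  assumes "\<And>i. i \<in> I \<Longrightarrow> (f i has_sum s i) A"
  shows "((\<lambda>x. \<Sum>i\<in>I. f i x) has_sum (\<Sum>i\<in>I. s i)) A"
  using assms
  by (induction I rule: infinite_finite_induct) (auto intro: has_sum_add)

text \<open>The Cauchy-Schwarz inequality for the positive form
  \<open>(X, Y) \<mapsto> \<Sum>\<^sub>y \<Sum>\<^sub>e p\<^sub>e \<langle>X\<^sub>y e, P(A\<^sub>y) Y\<^sub>y e\<rangle>\<close> at \<open>X\<^sub>y = cnj (a\<^sub>y)\<close> and \<open>Y\<^sub>y = w\<close>; as the \<open>P(A\<^sub>y)\<close> add up to
  the identity, the second factor does not depend on the partition.\<close>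

lemma qpm_partition_Cauchy_Schwarz:
  fixes P :: "'x set \<Rightarrow> 'h::chilbert_space \<Rightarrow> 'h" and a :: "'y \<Rightarrow> complex"
  assumes P: "qpm M P" and Y: "finite Y" "\<And>y. y \<in> Y \<Longrightarrow> A y \<in> sets M" "disjoint_family_on A Y"
    "(\<Union>y\<in>Y. A y) = space M"
    and p: "\<And>e. e \<in> E \<Longrightarrow> 0 \<le> p e"
    and \<nu>: "\<And>y. y \<in> Y \<Longrightarrow> ((\<lambda>e. p e * cinner e (P (A y) (w e))) has_sum \<nu> y) E"
    and \<mu>: "\<And>y. y \<in> Y \<Longrightarrow> ((\<lambda>e. p e * Re (cinner e (P (A y) e))) has_sum \<mu> y) E"
    and h: "((\<lambda>e. p e * (norm (w e))\<^sup>2) has_sum h) E"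
  shows "(cmod (\<Sum>y\<in>Y. a y * \<nu> y))\<^sup>2 \<le> (\<Sum>y\<in>Y. (cmod (a y))\<^sup>2 * \<mu> y) * h"
proof -
  let ?q = "\<lambda>y x. Re (cinner x (P (A y) x))"
  have q0: "0 \<le> ?q y x" if "y \<in> Y" for x y
    by (rule positive_op_nonneg[OF qpm_positive[OF P Y(2)[OF that]]])
  have bound: "(cmod (\<Sum>e\<in>F. \<Sum>y\<in>Y. a y * (p e * cinner e (P (A y) (w e)))))\<^sup>2
    \<le> (\<Sum>y\<in>Y. (cmod (a y))\<^sup>2 * \<mu> y) * h" if F: "finite F" "F \<subseteq> E" for F
  proof -
    let ?I = "F \<times> Y"
    \<comment> \<open>Two applications of Cauchy-Schwarz: first for each form
      \<open>P (A y)\<close>, then for the finite sum over pairs. The weight \<open>p e\<close> is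
      split evenly between the factors.\<close>
    let ?u = "\<lambda>(e, y). cmod (a y) * sqrt (p e * ?q y e)" and ?v = "\<lambda>(e, y). sqrt (p e * ?q y (w e))"
    have pF: "0 \<le> p e" if "e \<in> F" for e using that p F by auto
    have "cmod (\<Sum>e\<in>F. \<Sum>y\<in>Y. a y * (p e * cinner e (P (A y) (w e))))
      \<le> (\<Sum>(e, y)\<in>?I. cmod (a y * (p e * cinner e (P (A y) (w e)))))"
      unfolding sum.cartesian_product by (rule order_trans[OF norm_sum]) (simp add: case_prod_unfold)
    also have "\<dots> \<le> (\<Sum>i\<in>?I. ?u i * ?v i)"
    proof (rule sum_mono)
      fix i assume "i \<in> ?I"
      then obtain e y where ey: "i = (e, y)" "e \<in> F" "y \<in> Y" by auto
      have "(cmod (cinner e (P (A y) (w e))))\<^sup>2 \<le> ?q y e * ?q y (w e)"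
        by (rule positive_op_Cauchy_Schwarz[OF qpm_positive[OF P Y(2)[OF ey(3)]]])
      then have "cmod (cinner e (P (A y) (w e))) \<le> sqrt (?q y e) * sqrt (?q y (w e))"
        by (simp add: real_le_rsqrt flip: real_sqrt_mult)
      then have "cmod (a y) * p e * cmod (cinner e (P (A y) (w e)))
        \<le> cmod (a y) * p e * (sqrt (?q y e) * sqrt (?q y (w e)))"
        using pF[OF ey(2)] by (intro mult_left_mono) auto
      also have "\<dots> = cmod (a y) * (sqrt (p e) * sqrt (p e)) * (sqrt (?q y e) * sqrt (?q y (w e)))"
        using pF[OF ey(2)] by simp
      also have "\<dots> = ?u (e, y) * ?v (e, y)"
        by (simp only: prod.case real_sqrt_mult mult_ac)
      finally show "(case i of (e, y) \<Rightarrow> cmod (a y * (p e * cinner e (P (A y) (w e))))) \<le> ?u i * ?v i"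
        using pF[OF ey(2)] by (simp add: ey(1) norm_mult mult.assoc)
    qed
    finally have "(cmod (\<Sum>e\<in>F. \<Sum>y\<in>Y. a y * (p e * cinner e (P (A y) (w e)))))\<^sup>2
      \<le> (\<Sum>i\<in>?I. ?u i * ?v i)\<^sup>2"
      by (rule power_mono) simp
    also have "\<dots> \<le> (\<Sum>i\<in>?I. (?u i)\<^sup>2) * (\<Sum>i\<in>?I. (?v i)\<^sup>2)"
      by (rule Cauchy_Schwarz_ineq_sum)
    also have "\<dots> \<le> (\<Sum>y\<in>Y. (cmod (a y))\<^sup>2 * \<mu> y) * h"
    proof (rule mult_mono)
      have "(\<Sum>i\<in>?I. (?u i)\<^sup>2) = (\<Sum>e\<in>F. \<Sum>y\<in>Y. (cmod (a y))\<^sup>2 * (p e * ?q y e))"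
        unfolding sum.cartesian_product
        by (intro sum.cong) (auto simp: power_mult_distrib pF q0)
      also have "\<dots> = (\<Sum>y\<in>Y. (cmod (a y))\<^sup>2 * (\<Sum>e\<in>F. p e * ?q y e))"
        unfolding sum_distrib_left by (rule sum.swap)
      also have "\<dots> \<le> (\<Sum>y\<in>Y. (cmod (a y))\<^sup>2 * \<mu> y)"
        by (intro sum_mono mult_left_mono finite_sum_le_has_sum[OF \<mu> F]) (auto simp: p q0)
      finally show "(\<Sum>i\<in>?I. (?u i)\<^sup>2) \<le> (\<Sum>y\<in>Y. (cmod (a y))\<^sup>2 * \<mu> y)" .
      have "(\<Sum>i\<in>?I. (?v i)\<^sup>2) = (\<Sum>e\<in>F. \<Sum>y\<in>Y. p e * ?q y (w e))"
        unfolding sum.cartesian_product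
        by (intro sum.cong) (auto simp: pF q0)
      also have "\<dots> = (\<Sum>e\<in>F. p e * Re (\<Sum>y\<in>Y. cinner (w e) (P (A y) (w e))))"
        by (simp add: sum_distrib_left)
      also have "\<dots> = (\<Sum>e\<in>F. p e * (norm (w e))\<^sup>2)"
        by (simp add: Re_cinner_self Y(4) qpm_space[OF P] flip: qpm_finite_Union[OF P Y(1-3)])
      also have "\<dots> \<le> h"
        by (rule finite_sum_le_has_sum[OF h F]) (simp add: p)
      finally show "(\<Sum>i\<in>?I. (?v i)\<^sup>2) \<le> h" .
      show "0 \<le> (\<Sum>y\<in>Y. (cmod (a y))\<^sup>2 * \<mu> y)"
        by (intro sum_nonneg mult_nonneg_nonneg has_sum_nonneg[OF \<mu>]) (auto simp: p q0)
      show "0 \<le> (\<Sum>i\<in>?I. (?v i)\<^sup>2)" by (simp add: sum_nonneg)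
    qed
    finally show ?thesis .
  qed
  \<comment> \<open>The bound is independent of \<open>F\<close>, so it survives the limit over
    finite subsets of \<open>E\<close>.\<close>
  have "((\<lambda>e. \<Sum>y\<in>Y. a y * (p e * cinner e (P (A y) (w e)))) has_sum (\<Sum>y\<in>Y. a y * \<nu> y)) E"
    by (intro has_sum_sum has_sum_cmult_right \<nu>)
  then have "((\<lambda>F. (cmod (\<Sum>e\<in>F. \<Sum>y\<in>Y. a y * (p e * cinner e (P (A y) (w e)))))\<^sup>2)
    \<longlongrightarrow> (cmod (\<Sum>y\<in>Y. a y * \<nu> y))\<^sup>2) (finite_subsets_at_top E)"
    unfolding has_sum_def by (intro tendsto_intros)
  then show ?thesis
    by (rule tendsto_upperbound) (auto intro!: eventually_finite_subsets_at_top_weakI bound)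
qed

subsection \<open>Approximation by simple functions\<close>

lemma integral_simple_compose:
  fixes G :: "'c \<Rightarrow> 'b::{banach, second_countable_topology}"
  assumes "finite_measure M" "simple_function M s"
  shows "(\<integral>x. G (s x) \<partial>M) = (\<Sum>y\<in>s ` space M. measure M (s -` {y} \<inter> space M) *\<^sub>R G y)"
proof -
  interpret finite_measure M by fact
  have s: "finite (s ` space M)" "\<And>y. y \<in> s ` space M \<Longrightarrow> s -` {y} \<inter> space M \<in> sets M"
    using assms(2) by (auto simp: simple_function_def)
  have "(\<integral>x. G (s x) \<partial>M) = (\<integral>x. (\<Sum>y\<in>s ` space M. indicator (s -` {y} \<inter> space M) x *\<^sub>R G y) \<partial>M)"
  proof (rule Bochner_Integration.integral_cong[OF refl])
    fix x assume x: "x \<in> space M"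
    have "(\<Sum>y\<in>s ` space M. indicator (s -` {y} \<inter> space M) x *\<^sub>R G y)
      = (\<Sum>y\<in>s ` space M. if y = s x then G y else 0)"
      using x by (intro sum.cong) auto
    then show "G (s x) = (\<Sum>y\<in>s ` space M. indicator (s -` {y} \<inter> space M) x *\<^sub>R G y)"
      using x s(1) by simp
  qed
  also have "\<dots> = (\<Sum>y\<in>s ` space M. (\<integral>x. indicator (s -` {y} \<inter> space M) x *\<^sub>R G y \<partial>M))"
    using s(2) by (intro Bochner_Integration.integral_sum integrable_scaleR_left)
      (auto simp: emeasure_eq_measure integrable_indicator_iff less_top[symmetric])
  also have "\<dots> = (\<Sum>y\<in>s ` space M. measure M (s -` {y} \<inter> space M) *\<^sub>R G y)"
  proof (intro sum.cong refl)
    fix y assume "y \<in> s ` space M"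
    then have "integrable M (indicator (s -` {y} \<inter> space M) :: _ \<Rightarrow> real)"
      using s(2) by (auto simp: emeasure_eq_measure integrable_indicator_iff less_top[symmetric])
    then show "(\<integral>x. indicator (s -` {y} \<inter> space M) x *\<^sub>R G y \<partial>M)
      = measure M (s -` {y} \<inter> space M) *\<^sub>R G y"
      by simp
  qed
  finally show ?thesis .
qed

lemma simple_function_compose_measurable:
  assumes "simple_function M s"
  shows "(\<lambda>x. G (s x)) \<in> borel_measurable M"
  using simple_function_compose[OF assms, of G] by (intro borel_measurable_simple_function) (simp add: o_def)

text \<open>Dominated convergence. The integrand is \<open>G\<close> composed with a simple
  function, so that one partition can later serve several functions \<open>G\<close>.\<close>

lemma finite_measure_simple_limit:
  fixes f :: "'a \<Rightarrow> complex"
  assumes M: "finite_measure M" and f: "integrable M f" and S: "\<And>N. simple_function M (S N)"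
    and lim: "\<And>x. x \<in> space M \<Longrightarrow> (\<lambda>N. G (S N x)) \<longlonglongrightarrow> f x - t"
    and dom: "\<And>N x. x \<in> space M \<Longrightarrow> norm (G (S N x)) \<le> 2 * norm (f x - t)"
  shows "(\<lambda>N. \<Sum>y\<in>S N ` space M. G y * measure M (S N -` {y} \<inter> space M))
    \<longlonglongrightarrow> (\<integral>x. f x \<partial>M) - t * measure M (space M)"
proof -
  interpret finite_measure M by fact
  have int: "integrable M (\<lambda>x. f x - t)" using f by simp
  have "(\<lambda>N. \<integral>x. G (S N x) \<partial>M) \<longlonglongrightarrow> (\<integral>x. f x - t \<partial>M)"
    by (rule integral_dominated_convergence[where w = "\<lambda>x. 2 * norm (f x - t)",
          OF _ simple_function_compose_measurable[OF S]])
      (use int lim dom in auto)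
  moreover have "(\<integral>x. f x - t \<partial>M) = (\<integral>x. f x \<partial>M) - t * measure M (space M)"
    using f by (simp add: scaleR_conv_of_real mult.commute)
  ultimately show ?thesis
    by (simp add: integral_simple_compose[OF M S] scaleR_conv_of_real mult.commute)
qed

text \<open>The positive-measure case is applied to the four components and recombined. The
  approximating sums involve \<open>\<nu>\<close> only.\<close>

lemma complex_measure_simple_limit:
  fixes f :: "'a \<Rightarrow> complex"
  assumes I: "has_complex_measure_integral M \<nu> f I" and S: "\<And>N. simple_function M (S N)"
    and lim: "\<And>x. x \<in> space M \<Longrightarrow> (\<lambda>N. G (S N x)) \<longlonglongrightarrow> f x - t"
    and dom: "\<And>N x. x \<in> space M \<Longrightarrow> norm (G (S N x)) \<le> 2 * norm (f x - t)"
  shows "(\<lambda>N. \<Sum>y\<in>S N ` space M. G y * \<nu> (S N -` {y} \<inter> space M)) \<longlonglongrightarrow> I - t * \<nu> (space M)"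
proof -
  obtain \<mu>1 \<mu>2 \<mu>3 \<mu>4 where
    \<mu>: "\<And>\<mu>. \<mu> \<in> {\<mu>1, \<mu>2, \<mu>3, \<mu>4} \<Longrightarrow> finite_measure \<mu> \<and> sets \<mu> = sets M \<and> integrable \<mu> f"
    and \<nu>: "\<And>B. B \<in> sets M \<Longrightarrow> \<nu> B = complex_of_real (measure \<mu>1 B - measure \<mu>2 B)
                     + \<i> * complex_of_real (measure \<mu>3 B - measure \<mu>4 B)"
    and I: "I = (\<integral>x. f x \<partial>\<mu>1) - (\<integral>x. f x \<partial>\<mu>2) + \<i> * ((\<integral>x. f x \<partial>\<mu>3) - (\<integral>x. f x \<partial>\<mu>4))"
    using I unfolding has_complex_measure_integral_def by metis
  let ?J = "\<lambda>\<mu> N. \<Sum>y\<in>S N ` space M. G y * complex_of_real (measure \<mu> (S N -` {y} \<inter> space M))"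
  have J: "?J \<mu> \<longlonglongrightarrow> (\<integral>x. f x \<partial>\<mu>) - t * measure \<mu> (space M)" if "\<mu> \<in> {\<mu>1, \<mu>2, \<mu>3, \<mu>4}" for \<mu>
  proof -
    have sp: "space \<mu> = space M" using \<mu>[OF that] sets_eq_imp_space_eq by blast
    have "simple_function \<mu> (S N)" for N
      using S \<mu>[OF that] sp by (simp add: simple_function_def)
    then show ?thesis
      using finite_measure_simple_limit[of \<mu> f S G t] \<mu>[OF that] lim dom unfolding sp by blast
  qed
  have J_eq: "(\<lambda>N. \<Sum>y\<in>S N ` space M. G y * \<nu> (S N -` {y} \<inter> space M))
    = (\<lambda>N. ?J \<mu>1 N - ?J \<mu>2 N + \<i> * (?J \<mu>3 N - ?J \<mu>4 N))"
  proof
    fix N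
    have "(\<Sum>y\<in>S N ` space M. G y * \<nu> (S N -` {y} \<inter> space M))
      = (\<Sum>y\<in>S N ` space M. G y * (complex_of_real (measure \<mu>1 (S N -` {y} \<inter> space M)
          - measure \<mu>2 (S N -` {y} \<inter> space M))
        + \<i> * complex_of_real (measure \<mu>3 (S N -` {y} \<inter> space M) - measure \<mu>4 (S N -` {y} \<inter> space M))))"
      by (intro sum.cong refl, subst \<nu>) (use S[of N] in \<open>auto simp: simple_function_def\<close>)
    then show "(\<Sum>y\<in>S N ` space M. G y * \<nu> (S N -` {y} \<inter> space M))
      = ?J \<mu>1 N - ?J \<mu>2 N + \<i> * (?J \<mu>3 N - ?J \<mu>4 N)"
      by (simp add: sum_distrib_left algebra_simps sum.distrib sum_subtractf)
  qed
  have \<nu>_space: "\<nu> (space M) = complex_of_real (measure \<mu>1 (space M) - measure \<mu>2 (space M))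
    + \<i> * complex_of_real (measure \<mu>3 (space M) - measure \<mu>4 (space M))"
    by (rule \<nu>) simp
  have lim_eq: "((\<integral>x. f x \<partial>\<mu>1) - t * measure \<mu>1 (space M)) - ((\<integral>x. f x \<partial>\<mu>2) - t * measure \<mu>2 (space M))
    + \<i> * (((\<integral>x. f x \<partial>\<mu>3) - t * measure \<mu>3 (space M)) - ((\<integral>x. f x \<partial>\<mu>4) - t * measure \<mu>4 (space M)))
    = I - t * \<nu> (space M)"
    unfolding I \<nu>_space by (simp add: algebra_simps)
  show ?thesis
    unfolding J_eq lim_eq[symmetric] by (intro tendsto_add tendsto_diff tendsto_mult tendsto_const J) auto
qed

lemma simple_function_vec_lambda:
  fixes s :: "'m::finite \<Rightarrow> 'a \<Rightarrow> 'b"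
  assumes "\<And>i. simple_function M (s i)"
  shows "simple_function M (\<lambda>x. \<chi> i. s i x)"
  unfolding simple_function_def
proof (intro conjI ballI)
  have "(\<lambda>x. \<chi> i. s i x) ` space M \<subseteq> vec_lambda ` (PiE UNIV (\<lambda>i. s i ` space M))"
    by auto
  then show "finite ((\<lambda>x. \<chi> i. s i x) ` space M)"
    using assms by (elim finite_subset) (auto intro!: finite_PiE simp: simple_function_def)
next
  fix y
  have "(\<lambda>x. \<chi> i. s i x) -` {y} \<inter> space M = (\<Inter>i. s i -` {y $ i} \<inter> space M)"
    by (auto simp: vec_eq_iff)
  also have "\<dots> \<in> sets M"
    using simple_functionD(2)[OF assms] by (intro sets.countable_INT') auto
  finally show "(\<lambda>x. \<chi> i. s i x) -` {y} \<inter> space M \<in> sets M" .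
qed

subsection \<open>The Cramer-Rao inequality\<close>

text \<open>The partition inequality for \<open>W = \<Sum>k. c k *\<^sub>C w k\<close> and the level
  sets of simple functions \<open>S N\<close> converging to the identity. As \<open>N\<close> grows,
  both sides converge to the stated quantities.\<close>

lemma cramer_rao_bilinear:
  fixes P :: "(complex^'m) set \<Rightarrow> 'h::chilbert_space \<Rightarrow> 'h" and w :: "'n::finite \<Rightarrow> 'h \<Rightarrow> 'h"
    and D :: "complex^'n^'m" and H :: "complex^'n^'n"
  assumes P: "qpm borel P" and p: "\<And>e. e \<in> E \<Longrightarrow> 0 \<le> p e"
    and \<mu>: "finite_measure \<mu>" "sets \<mu> = sets borel"
      "\<And>B. B \<in> sets borel \<Longrightarrow> ((\<lambda>e. p e * Re (cinner e (P B e))) has_sum measure \<mu> B) E"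
    and sq: "\<And>i. integrable \<mu> (\<lambda>x. (cmod (x $ i - t $ i))\<^sup>2)"
    and \<nu>: "\<And>k B. B \<in> sets borel \<Longrightarrow> ((\<lambda>e. p e * cinner e (P B (w k e))) has_sum \<nu> k B) E"
    and \<nu>0: "\<And>k. \<nu> k UNIV = 0"
    and H: "\<And>k l. ((\<lambda>e. p e * cinner (w k e) (w l e)) has_sum H $ k $ l) E"
    and D: "\<And>i k. has_complex_measure_integral borel (\<nu> k) (\<lambda>x. x $ i) (D $ i $ k)"
  shows "(cmod (\<Sum>i\<in>UNIV. \<Sum>k\<in>UNIV. z i * D $ i $ k * c k))\<^sup>2
    \<le> (\<integral>x. (cmod (\<Sum>i\<in>UNIV. z i * (x $ i - t $ i)))\<^sup>2 \<partial>\<mu>)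
      * Re (\<Sum>k\<in>UNIV. \<Sum>l\<in>UNIV. cnj (c k) * H $ k $ l * c l)" (is "_ \<le> ?V * ?h")
proof -
  \<comment> \<open>Approximation relative to the base point \<open>t $ i\<close>: the distance to
    \<open>t $ i\<close> at most doubles, which supplies the dominating functions for both
    limits.\<close>
  have "\<exists>F. (\<forall>N. simple_function borel (F N)) \<and> (\<forall>x\<in>space borel. (\<lambda>N. F N x) \<longlonglongrightarrow> x $ i) \<and>
    (\<forall>N. \<forall>x\<in>space borel. dist (F N x) (t $ i) \<le> 2 * dist (x $ i) (t $ i))" for i
    by (intro borel_measurable_implies_sequence_metric borel_measurable_continuous_onI continuous_intros)
  then obtain s where s: "\<And>i N. simple_function borel (s i N)"
    "\<And>i x. (\<lambda>N. s i N x) \<longlonglongrightarrow> x $ i" "\<And>i N x. dist (s i N x) (t $ i) \<le> 2 * dist (x $ i) (t $ i)"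
    by (simp add: all_conj_distrib) metis
  define S :: "nat \<Rightarrow> complex^'m \<Rightarrow> complex^'m" where "S N x = (\<chi> i. s i N x)" for N x
  have S: "simple_function borel (S N)" for N
    unfolding S_def by (rule simple_function_vec_lambda[OF s(1)])
  have S_lim: "(\<lambda>N. S N x) \<longlonglongrightarrow> x" for x
    unfolding S_def by (rule vec_tendstoI) (simp add: s(2))
  have finS: "finite (range (S N))" and mS: "S N -` {y} \<in> sets borel" for N y
    using simple_functionD[OF S[of N]] by auto
  define a where "a x = (\<Sum>i\<in>UNIV. z i * (x $ i - t $ i))" for x :: "complex^'m"
  define W where "W e = (\<Sum>k\<in>UNIV. c k *\<^sub>C w k e)" for e

  have h: "((\<lambda>e. p e * (norm (W e))\<^sup>2) has_sum ?h) E"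
  proof -
    have "((\<lambda>e. \<Sum>k\<in>UNIV. \<Sum>l\<in>UNIV. cnj (c k) * (p e * cinner (w k e) (w l e)) * c l)
      has_sum (\<Sum>k\<in>UNIV. \<Sum>l\<in>UNIV. cnj (c k) * H $ k $ l * c l)) E"
      by (intro has_sum_sum has_sum_cmult_left has_sum_cmult_right H)
    moreover have "(\<Sum>k\<in>UNIV. \<Sum>l\<in>UNIV. cnj (c k) * (p e * cinner (w k e) (w l e)) * c l)
      = complex_of_real (p e * (norm (W e))\<^sup>2)" for e
      unfolding of_real_mult cinner_self[symmetric] W_def
      by (simp add: cinner_sum_left cinner_sum_right cinner_scaleC_left cinner_scaleC_right
          sum_distrib_left mult_ac) (rule sum.swap)
    ultimately show ?thesis
      using has_sum_Re by fastforce
  qed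
  have \<nu>W: "((\<lambda>e. p e * cinner e (P B (W e))) has_sum (\<Sum>k\<in>UNIV. c k * \<nu> k B)) E"
    if "B \<in> sets borel" for B
  proof -
    note lin = positive_op_clinear[OF qpm_positive[OF P that]]
    have "((\<lambda>e. \<Sum>k\<in>UNIV. c k * (p e * cinner e (P B (w k e)))) has_sum (\<Sum>k\<in>UNIV. c k * \<nu> k B)) E"
      by (intro has_sum_sum has_sum_cmult_right \<nu> that)
    then show ?thesis
      by (simp add: W_def clinear_sum[OF lin] clinear_scaleC[OF lin] cinner_sum_right
          cinner_scaleC_right sum_distrib_left mult_ac)
  qed
  have ineq: "(cmod (\<Sum>y\<in>range (S N). a y * (\<Sum>k\<in>UNIV. c k * \<nu> k (S N -` {y}))))\<^sup>2
    \<le> (\<Sum>y\<in>range (S N). (cmod (a y))\<^sup>2 * measure \<mu> (S N -` {y})) * ?h" for N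
    by (rule qpm_partition_Cauchy_Schwarz[OF P finS, where A = "\<lambda>y. S N -` {y}"])
      (use mS p \<nu>W \<mu>(3) h in \<open>auto simp: disjoint_family_on_def\<close>)

  have "(\<lambda>N. \<Sum>y\<in>range (S N). (y $ i - t $ i) * \<nu> k (S N -` {y})) \<longlonglongrightarrow> D $ i $ k" for i k
  proof -
    \<comment> \<open>Centering at \<open>t $ i\<close> does not change the limit because
      \<open>\<nu> k\<close> has total mass 0.\<close>
    have "(\<lambda>N. \<Sum>y\<in>S N ` space borel. (y $ i - t $ i) * \<nu> k (S N -` {y} \<inter> space borel))
      \<longlonglongrightarrow> D $ i $ k - t $ i * \<nu> k (space borel)"
      by (rule complex_measure_simple_limit[OF D S])
        (use s in \<open>auto simp: S_def dist_norm intro!: tendsto_intros\<close>)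
    then show ?thesis by (simp add: \<nu>0)
  qed
  then have "(\<lambda>N. \<Sum>i\<in>UNIV. \<Sum>k\<in>UNIV. z i * (\<Sum>y\<in>range (S N). (y $ i - t $ i) * \<nu> k (S N -` {y})) * c k)
    \<longlonglongrightarrow> (\<Sum>i\<in>UNIV. \<Sum>k\<in>UNIV. z i * D $ i $ k * c k)"
    by (intro tendsto_intros)
  moreover have "(\<Sum>i\<in>UNIV. \<Sum>k\<in>UNIV. z i * (\<Sum>y\<in>range (S N). (y $ i - t $ i) * \<nu> k (S N -` {y})) * c k)
    = (\<Sum>y\<in>range (S N). a y * (\<Sum>k\<in>UNIV. c k * \<nu> k (S N -` {y})))" (is "?L = ?R") for N
  proof -
    have "?L = (\<Sum>i\<in>UNIV. \<Sum>k\<in>UNIV. \<Sum>y\<in>range (S N). z i * (y $ i - t $ i) * (c k * \<nu> k (S N -` {y})))"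
      by (simp add: sum_distrib_left sum_distrib_right mult_ac)
    also have "\<dots> = (\<Sum>i\<in>UNIV. \<Sum>y\<in>range (S N). \<Sum>k\<in>UNIV. z i * (y $ i - t $ i) * (c k * \<nu> k (S N -` {y})))"
      by (intro sum.cong refl sum.swap)
    also have "\<dots> = (\<Sum>y\<in>range (S N). \<Sum>i\<in>UNIV. \<Sum>k\<in>UNIV. z i * (y $ i - t $ i) * (c k * \<nu> k (S N -` {y})))"
      by (rule sum.swap)
    also have "\<dots> = ?R"
      unfolding a_def sum_product ..
    finally show ?thesis .
  qed
  ultimately have lhs: "(\<lambda>N. (cmod (\<Sum>y\<in>range (S N). a y * (\<Sum>k\<in>UNIV. c k * \<nu> k (S N -` {y}))))\<^sup>2)
    \<longlonglongrightarrow> (cmod (\<Sum>i\<in>UNIV. \<Sum>k\<in>UNIV. z i * D $ i $ k * c k))\<^sup>2"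
    by (intro tendsto_intros) simp

  have sp: "space \<mu> = UNIV" using sets_eq_imp_space_eq[OF \<mu>(2)] by simp
  have S\<mu>: "simple_function \<mu> (S N)" for N
    using S[of N] \<mu>(2) sp by (simp add: simple_function_def)
  have am: "(\<lambda>x. (cmod (a x))\<^sup>2) \<in> borel_measurable \<mu>"
    unfolding measurable_cong_sets[OF \<mu>(2) refl] a_def
    by (intro borel_measurable_continuous_onI continuous_intros)
  have "(\<lambda>N. \<integral>x. (cmod (a (S N x)))\<^sup>2 \<partial>\<mu>) \<longlonglongrightarrow> ?V"
    unfolding a_def[symmetric]
  \<comment> \<open>The dominating function is Cauchy-Schwarz over the coordinates; the factor 4 is
    the square of the approximation factor 2.\<close>
  proof (rule integral_dominated_convergence[where
        w = "\<lambda>x. (\<Sum>i\<in>UNIV. (cmod (z i))\<^sup>2) * (\<Sum>i\<in>UNIV. 4 * (cmod (x $ i - t $ i))\<^sup>2)"])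
    show "integrable \<mu> (\<lambda>x. (\<Sum>i\<in>UNIV. (cmod (z i))\<^sup>2) * (\<Sum>i\<in>UNIV. 4 * (cmod (x $ i - t $ i))\<^sup>2))"
      by (intro integrable_mult_right Bochner_Integration.integrable_sum sq)
    show "AE x in \<mu>. (\<lambda>N. (cmod (a (S N x)))\<^sup>2) \<longlonglongrightarrow> (cmod (a x))\<^sup>2"
      unfolding a_def by (intro AE_I2 tendsto_intros S_lim)
    fix N
    have "(cmod (a (S N x)))\<^sup>2 \<le> (\<Sum>i\<in>UNIV. (cmod (z i))\<^sup>2) * (\<Sum>i\<in>UNIV. 4 * (cmod (x $ i - t $ i))\<^sup>2)" for x
    proof -
      have "cmod (a (S N x)) \<le> (\<Sum>i\<in>UNIV. cmod (z i) * (2 * cmod (x $ i - t $ i)))"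
        unfolding a_def S_def using s(3)[of _ N x]
        by (intro sum_norm_le) (auto simp: norm_mult dist_norm intro!: mult_left_mono)
      then have "(cmod (a (S N x)))\<^sup>2 \<le> (\<Sum>i\<in>UNIV. cmod (z i) * (2 * cmod (x $ i - t $ i)))\<^sup>2"
        by (rule power_mono) simp
      also have "\<dots> \<le> (\<Sum>i\<in>UNIV. (cmod (z i))\<^sup>2) * (\<Sum>i\<in>UNIV. (2 * cmod (x $ i - t $ i))\<^sup>2)"
        by (rule Cauchy_Schwarz_ineq_sum)
      finally show ?thesis by (simp add: power_mult_distrib)
    qed
    then show "AE x in \<mu>. norm ((cmod (a (S N x)))\<^sup>2)
      \<le> (\<Sum>i\<in>UNIV. (cmod (z i))\<^sup>2) * (\<Sum>i\<in>UNIV. 4 * (cmod (x $ i - t $ i))\<^sup>2)"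
      by (intro AE_I2) simp
    show "(\<lambda>x. (cmod (a (S N x)))\<^sup>2) \<in> borel_measurable \<mu>"
      using simple_function_compose_measurable[OF S\<mu>, of "\<lambda>y. (cmod (a y))\<^sup>2"] .
  qed (rule am)
  then have "(\<lambda>N. \<Sum>y\<in>range (S N). (cmod (a y))\<^sup>2 * measure \<mu> (S N -` {y})) \<longlonglongrightarrow> ?V"
    using integral_simple_compose[OF \<mu>(1) S\<mu>, of "\<lambda>y. (cmod (a y))\<^sup>2"] by (simp add: sp mult.commute)
  then have "(\<lambda>N. (\<Sum>y\<in>range (S N). (cmod (a y))\<^sup>2 * measure \<mu> (S N -` {y})) * ?h) \<longlonglongrightarrow> ?V * ?h"
    by (intro tendsto_intros)
  from LIMSEQ_le[OF lhs this] ineq show ?thesis by blast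
qed

lemma conj_transpose_mult:
  "conj_transpose (A ** B) = conj_transpose B ** conj_transpose A"
  by (simp add: vec_eq_iff conj_transpose_def matrix_matrix_mult_def mult.commute)

lemma conj_transpose_conj_transpose [simp]: "conj_transpose (conj_transpose A) = A"
  by (simp add: vec_eq_iff conj_transpose_def)

lemma conj_transpose_diff: "conj_transpose (A - B) = conj_transpose A - conj_transpose B"
  by (simp add: vec_eq_iff conj_transpose_def)

lemma conj_transpose_mat_1: "conj_transpose (mat 1) = mat 1"
  by (simp add: vec_eq_iff conj_transpose_def mat_def)

lemma matrix_inv_right: "invertible A \<Longrightarrow> A ** matrix_inv A = mat 1"
  unfolding invertible_def matrix_inv_def by (drule someI_ex) blast

text \<open>With \<open>G\<close> the inverse, the adjoint of \<open>G\<close> equals itself times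
  \<open>H ** G\<close>; moving \<open>H\<close> to the left inside the adjoint leaves
  \<open>G\<close>.\<close>

lemma conj_transpose_matrix_inv:
  fixes H :: "complex^'n::finite^'n"
  assumes "conj_transpose H = H" "invertible H"
  shows "conj_transpose (matrix_inv H) = matrix_inv H"
proof -
  let ?G = "matrix_inv H"
  have G: "H ** ?G = mat 1"
    using assms(2) by (rule matrix_inv_right)
  have "conj_transpose ?G = conj_transpose ?G ** (H ** ?G)"
    by (simp add: G)
  also have "\<dots> = conj_transpose (H ** ?G) ** ?G"
    by (simp only: conj_transpose_mult assms(1) matrix_mul_assoc)
  also have "\<dots> = ?G"
    by (simp add: G conj_transpose_mat_1)
  finally show ?thesis .
qed

lemma cinner_conj_transpose:
  fixes A :: "complex^'n::finite^'m::finite"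
  shows "(\<Sum>i\<in>UNIV. cnj (u $ i) * (A *v v) $ i) = (\<Sum>k\<in>UNIV. cnj ((conj_transpose A *v u) $ k) * v $ k)"
proof -
  have "(\<Sum>i\<in>UNIV. cnj (u $ i) * (A *v v) $ i) = (\<Sum>i\<in>UNIV. \<Sum>k\<in>UNIV. cnj (u $ i) * A $ i $ k * v $ k)"
    by (simp add: matrix_vector_mult_def sum_distrib_left mult_ac)
  also have "\<dots> = (\<Sum>k\<in>UNIV. \<Sum>i\<in>UNIV. cnj (u $ i) * A $ i $ k * v $ k)"
    by (rule sum.swap)
  also have "\<dots> = (\<Sum>k\<in>UNIV. cnj ((conj_transpose A *v u) $ k) * v $ k)"
    by (simp add: matrix_vector_mult_def conj_transpose_def sum_distrib_left sum_distrib_right mult_ac)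
  finally show ?thesis .
qed

lemma quadratic_form_matrix_vector:
  fixes A :: "complex^'n::finite^'m::finite"
  shows "(\<Sum>i\<in>UNIV. \<Sum>j\<in>UNIV. cnj (u $ i) * A $ i $ j * v $ j) = (\<Sum>i\<in>UNIV. cnj (u $ i) * (A *v v) $ i)"
  by (simp add: matrix_vector_mult_def sum_distrib_left mult_ac)

text \<open>The bilinear inequality is used at \<open>c = H\<^sup>-\<^sup>1 D\<^sup>\<dagger> z\<close>, where \<open>z\<^sup>\<dagger> D c = c\<^sup>\<dagger> H c\<close>.\<close>

lemma matrix_ge_of_bilinear_bound:
  fixes R :: "complex^'m::finite^'m" and D :: "complex^'n::finite^'m" and H :: "complex^'n^'n"
  assumes R: "conj_transpose R = R" and H: "conj_transpose H = H" "invertible H"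
    and form: "\<And>z. (\<Sum>i\<in>UNIV. \<Sum>j\<in>UNIV. cnj (z $ i) * R $ i $ j * z $ j) = complex_of_real (r z)"
    and r: "\<And>z. 0 \<le> r z"
    and bound: "\<And>z c. (cmod (\<Sum>i\<in>UNIV. \<Sum>k\<in>UNIV. cnj (z $ i) * D $ i $ k * c $ k))\<^sup>2
      \<le> r z * Re (\<Sum>k\<in>UNIV. \<Sum>l\<in>UNIV. cnj (c $ k) * H $ k $ l * c $ l)"
  shows "matrix_ge R (D ** matrix_inv H ** conj_transpose D)"
  unfolding matrix_ge_def
proof (intro conjI allI)
  let ?G = "matrix_inv H"
  let ?B = "D ** ?G ** conj_transpose D"
  have G: "conj_transpose ?G = ?G"
    by (rule conj_transpose_matrix_inv[OF H])
  then have B: "conj_transpose ?B = ?B"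
    by (simp add: conj_transpose_mult matrix_mul_assoc)
  then show "conj_transpose (R - ?B) = R - ?B"
    by (simp add: conj_transpose_diff R)
  fix z :: "complex^'m"
  define u where "u = conj_transpose D *v z"
  define c where "c = ?G *v u"
  define q where "q = (\<Sum>k\<in>UNIV. cnj (u $ k) * c $ k)"
  have Hc: "H *v c = u"
    by (simp add: c_def matrix_vector_mul_assoc matrix_inv_right[OF H(2)])
  have "?B *v z = D *v c"
    by (simp add: c_def u_def matrix_vector_mul_assoc matrix_mul_assoc)
  then have Bq: "(\<Sum>i\<in>UNIV. \<Sum>j\<in>UNIV. cnj (z $ i) * ?B $ i $ j * z $ j) = q"
    by (simp only: quadratic_form_matrix_vector cinner_conj_transpose[of z D] u_def[symmetric] q_def)
  have Dq: "(\<Sum>i\<in>UNIV. \<Sum>k\<in>UNIV. cnj (z $ i) * D $ i $ k * c $ k) = q"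
    by (simp only: quadratic_form_matrix_vector cinner_conj_transpose[of z D] u_def[symmetric] q_def)
  have Hq: "(\<Sum>k\<in>UNIV. \<Sum>l\<in>UNIV. cnj (c $ k) * H $ k $ l * c $ l) = q"
    by (subst quadratic_form_matrix_vector, subst cinner_conj_transpose) (simp only: H(1) Hc q_def)
  \<comment> \<open>Reading \<open>q\<close> once through \<open>D\<close> and once through
    \<open>H\<close> shows that it equals its own conjugate.\<close>
  have "q = (\<Sum>k\<in>UNIV. cnj (c $ k) * u $ k)"
    by (rule Hq[unfolded quadratic_form_matrix_vector Hc, symmetric])
  also have "\<dots> = cnj q"
    by (simp add: q_def mult.commute)
  finally have "q = cnj q" .
  then have q: "q = complex_of_real (Re q)"
    by (simp add: complex_eq_iff)
  have "(Re q)\<^sup>2 \<le> r z * Re q"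
    using bound[of z c] unfolding Dq Hq by (subst (asm) q) simp
  \<comment> \<open>If \<open>Re q > 0\<close> it can be cancelled; otherwise
    \<open>r z \<ge> 0\<close> suffices.\<close>
  then have "Re q \<le> r z"
    using r[of z] by (cases "0 < Re q") (auto simp: power2_eq_square)
  moreover have "(\<Sum>i\<in>UNIV. \<Sum>j\<in>UNIV. cnj (z $ i) * (R - ?B) $ i $ j * z $ j)
    = complex_of_real (r z) - q"
    unfolding Bq[symmetric] form[symmetric] by (simp add: algebra_simps sum_subtractf)
  then have "(\<Sum>i\<in>UNIV. \<Sum>j\<in>UNIV. cnj (z $ i) * (R - ?B) $ i $ j * z $ j)
    = complex_of_real (r z - Re q)"
    by (subst (asm) q) simp
  ultimately show "(\<Sum>i\<in>UNIV. \<Sum>j\<in>UNIV. cnj (z $ i) * (R - ?B) $ i $ j * z $ j) \<in> \<real>\<^sub>\<ge>\<^sub>0"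
    by (simp only: nonneg_Reals_of_real_iff diff_ge_0_iff_ge)
qed

lemma covariance_matrix_hermitian:
  "conj_transpose (covariance_matrix \<mu> t) = covariance_matrix \<mu> t"
proof -
  have "cnj (\<integral>x. (x $ j - t $ j) * cnj (x $ i - t $ i) \<partial>\<mu>)
    = (\<integral>x. (x $ i - t $ i) * cnj (x $ j - t $ j) \<partial>\<mu>)" for i j
    by (subst Bochner_Integration.integral_cnj[symmetric]) (simp add: mult.commute)
  then show ?thesis
    by (simp add: vec_eq_iff conj_transpose_def covariance_matrix_def)
qed

lemma covariance_quadratic_form:
  fixes t z :: "complex^'m::finite"
  assumes "\<And>i j. integrable \<mu> (\<lambda>x. (x $ i - t $ i) * cnj (x $ j - t $ j))"
  shows "(\<Sum>i\<in>UNIV. \<Sum>j\<in>UNIV. cnj (z $ i) * covariance_matrix \<mu> t $ i $ j * z $ j)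
    = complex_of_real (\<integral>x. (cmod (\<Sum>i\<in>UNIV. cnj (z $ i) * (x $ i - t $ i)))\<^sup>2 \<partial>\<mu>)"
proof -
  have "(\<Sum>i\<in>UNIV. \<Sum>j\<in>UNIV. cnj (z $ i) * covariance_matrix \<mu> t $ i $ j * z $ j)
    = (\<integral>x. (\<Sum>i\<in>UNIV. \<Sum>j\<in>UNIV. cnj (z $ i) * ((x $ i - t $ i) * cnj (x $ j - t $ j)) * z $ j) \<partial>\<mu>)"
    by (simp add: covariance_matrix_def assms Bochner_Integration.integral_sum
        Bochner_Integration.integrable_sum integrable_mult_left integrable_mult_right
        del: complex_cnj_diff)
  also have "\<dots> = (\<integral>x. complex_of_real ((cmod (\<Sum>i\<in>UNIV. cnj (z $ i) * (x $ i - t $ i)))\<^sup>2) \<partial>\<mu>)"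
    unfolding complex_norm_square
    by (rule Bochner_Integration.integral_cong)
      (simp_all add: sum_product mult_ac)
  finally show ?thesis by (simp del: of_real_power)
qed

theorem mainTheorem1:
  fixes \<O> :: "(complex^'n) set"
    and \<rho> :: "complex^'n \<Rightarrow> 'h::chilbert_space \<Rightarrow> 'h"
    and h :: "'n \<Rightarrow> complex^'n \<Rightarrow> 'h \<rightharpoonup> 'h"
    and \<theta> :: "complex^'n \<Rightarrow> complex^'m"
    and P :: "(complex^'m) set \<Rightarrow> 'h \<Rightarrow> 'h"
  assumes domain: "open \<O>" "connected \<O>" "\<O> \<noteq> {}"
    and density: "\<And>\<alpha>. \<alpha> \<in> \<O> \<Longrightarrow> density_operator (\<rho> \<alpha>)"
    and smooth: "\<And>\<alpha> \<phi>. \<alpha> \<in> \<O> \<Longrightarrow> (\<lambda>\<beta>. \<rho> \<beta> \<phi>) differentiable (at \<alpha>)"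
    and rld: "\<And>\<alpha> k. \<alpha> \<in> \<O> \<Longrightarrow> right_log_derivative k \<rho> \<alpha> (h k \<alpha>)"
    and info_defined: "\<And>\<alpha> k l. \<alpha> \<in> \<O> \<Longrightarrow>
          dom (info_op (h k \<alpha>) (h l \<alpha>) (\<rho> \<alpha>)) = UNIV \<and>
          (\<exists>t. has_trace (\<lambda>\<phi>. the (info_op (h k \<alpha>) (h l \<alpha>) (\<rho> \<alpha>) \<phi>)) t)"
    and nondegenerate: "\<And>\<alpha>. \<alpha> \<in> \<O> \<Longrightarrow> invertible (info_matrix (\<lambda>k. h k \<alpha>) (\<rho> \<alpha>))"
    and theta_diff: "\<And>\<alpha>. \<alpha> \<in> \<O> \<Longrightarrow> \<theta> differentiable (at \<alpha>)"
    and qpm: "qpm borel P"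
    and unbiased: "\<And>\<alpha> i. \<alpha> \<in> \<O> \<Longrightarrow>
          has_bochner_integral (outcome_distr borel P (\<rho> \<alpha>)) (\<lambda>x. x $ i) (\<theta> \<alpha> $ i)"
    and covariance_finite: "\<And>\<alpha> i j. \<alpha> \<in> \<O> \<Longrightarrow>
          integrable (outcome_distr borel P (\<rho> \<alpha>))
            (\<lambda>x. (x $ i - \<theta> \<alpha> $ i) * cnj (x $ j - \<theta> \<alpha> $ j))"
    and traces_defined: "\<And>\<alpha> k B. \<alpha> \<in> \<O> \<Longrightarrow> B \<in> sets borel \<Longrightarrow>
          \<exists>t. has_trace (P B \<circ> op_wirtinger k \<rho> \<alpha>) t"
    and interchange_trace: "\<And>\<alpha> k. \<alpha> \<in> \<O> \<Longrightarrow>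
          wirtinger k (\<lambda>\<beta>. Tr (\<rho> \<beta>)) \<alpha> = Tr (op_wirtinger k \<rho> \<alpha>)"
    and interchange_mean: "\<And>\<alpha> i k. \<alpha> \<in> \<O> \<Longrightarrow>
          has_complex_measure_integral borel (\<lambda>B. Tr (P B \<circ> op_wirtinger k \<rho> \<alpha>)) (\<lambda>x. x $ i)
            (wirtinger k (\<lambda>\<beta>. \<integral>x. x $ i \<partial>outcome_distr borel P (\<rho> \<beta>)) \<alpha>)"
  shows "\<forall>\<alpha>\<in>\<O>. matrix_ge
           (covariance_matrix (outcome_distr borel P (\<rho> \<alpha>)) (\<theta> \<alpha>))
           (wirtinger_matrix \<theta> \<alpha> ** matrix_inv (info_matrix (\<lambda>k. h k \<alpha>) (\<rho> \<alpha>))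
             ** conj_transpose (wirtinger_matrix \<theta> \<alpha>))"
proof
  fix \<alpha> assume \<alpha>: "\<alpha> \<in> \<O>"
  let ?r = "\<rho> \<alpha>" and ?\<mu> = "outcome_distr borel P (\<rho> \<alpha>)" and ?t = "\<theta> \<alpha>"
  let ?H = "info_matrix (\<lambda>k. h k \<alpha>) ?r" and ?D = "wirtinger_matrix \<theta> \<alpha>"
  let ?d = "\<lambda>k. op_wirtinger k \<rho> \<alpha>"
  have pos: "positive_op (\<rho> \<beta>)" "has_trace (\<rho> \<beta>) 1" if "\<beta> \<in> \<O>" for \<beta>
    using density[OF that] by (auto simp: density_operator_def)
  \<comment> \<open>The eigenbasis is taken at the single point \<open>\<alpha>\<close> and is never
    differentiated; the variation of \<open>\<rho>\<close> enters only through
    \<open>?d k\<close>.\<close>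
  obtain E where E: "orthonormal_basis E" and diag: "\<And>e. e \<in> E \<Longrightarrow> ?r e = Re (cinner e (?r e)) *\<^sub>R e"
    using positive_trace_diagonalizable[OF pos[OF \<alpha>]] by blast
  define p where "p e = Re (cinner e (?r e))" for e
  have p: "0 \<le> p e" for e
    unfolding p_def by (rule positive_op_nonneg[OF pos(1)[OF \<alpha>]])
  note diag = diag[folded p_def]

  have dense: "densely_defined_op (h k \<alpha>)" for k
    using rld[OF \<alpha>] by (simp add: right_log_derivative_def)
  \<comment> \<open>The weak form of the adjoint identity: \<open>?d k\<close> is the adjoint of
    \<open>h k \<alpha>\<close> applied after \<open>?r\<close>.\<close>
  have adj: "cinner (?r \<psi>) (the (h k \<alpha> \<phi>)) = cinner (?d k \<psi>) \<phi>" if "\<phi> \<in> dom (h k \<alpha>)" for k \<psi> \<phi>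
  proof -
    have "?r (the (h k \<alpha> \<phi>)) = op_wirtinger_bar k \<rho> \<alpha> \<phi>"
      using rld[OF \<alpha>] that by (simp add: right_log_derivative_def)
    then show ?thesis
      using positive_op_symmetric[OF pos(1)[OF \<alpha>], of \<psi> "the (h k \<alpha> \<phi>)"]
        cinner_op_wirtinger_bar[OF domain(1) \<alpha> pos(1) smooth[OF \<alpha>], of \<psi> k \<phi>] by simp
  qed
  have info: "info_op (h k \<alpha>) (h l \<alpha>) ?r \<psi> \<noteq> None" for k l \<psi>
    using info_defined[OF \<alpha>, of k l] by blast
  \<comment> \<open>For \<^term>\<open>p e = 0\<close> this is \<open>0\<close>, as it should: then \<open>\<partial>\<rho>/\<partial>\<alpha>\<^sup>k\<close> annihilates \<^term>\<open>e\<close>.\<close>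
  define w where "w k e = (1 / p e) *\<^sub>R ?d k e" for k e
  have dw: "?d k e = p e *\<^sub>R w k e" if "e \<in> E" for k e
    unfolding w_def by (rule info_op_eigenvector(2)[OF dense dense adj adj info diag[OF that]])
  have H: "((\<lambda>e. p e * cinner (w k e) (w l e)) has_sum ?H $ k $ l) E" for k l
  proof -
    have "((\<lambda>e. cinner e (the (info_op (h k \<alpha>) (h l \<alpha>) ?r e))) has_sum ?H $ k $ l) E"
      unfolding info_matrix_def using info_defined[OF \<alpha>, of k l] by (simp add: has_sum_Tr[OF _ E])
    then show ?thesis
      unfolding w_def
      by (rule has_sum_cong[THEN iffD1, rotated])
        (rule info_op_eigenvector(1)[OF dense dense adj adj info diag])
  qed
  have H_herm: "conj_transpose ?H = ?H"
  proof -
    have "cnj (?H $ l $ k) = ?H $ k $ l" for k l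
    proof (rule has_sum_unique[OF _ H])
      have "((\<lambda>e. cnj (p e * cinner (w l e) (w k e))) has_sum cnj (?H $ l $ k)) E"
        unfolding has_sum_cnj_iff by (rule H)
      then show "((\<lambda>e. p e * cinner (w k e) (w l e)) has_sum cnj (?H $ l $ k)) E"
        by (simp only: complex_cnj_mult complex_cnj_complex_of_real cinner_commute[symmetric])
    qed
    then show ?thesis by (simp add: vec_eq_iff conj_transpose_def)
  qed

  define \<nu> where "\<nu> k B = Tr (P B \<circ> ?d k)" for k B
  have \<nu>: "((\<lambda>e. p e * cinner e (P B (w k e))) has_sum \<nu> k B) E" if "B \<in> sets borel" for k B
  proof -
    note lin = positive_op_clinear[OF qpm_positive[OF qpm that]]
    have "((\<lambda>e. cinner e ((P B \<circ> ?d k) e)) has_sum \<nu> k B) E"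
      unfolding \<nu>_def by (rule has_sum_Tr[OF traces_defined[OF \<alpha> that] E])
    moreover have "cinner e ((P B \<circ> ?d k) e) = p e * cinner e (P B (w k e))" if "e \<in> E" for e
      by (simp add: dw[OF that] clinear_scaleC[OF lin] cinner_scaleC_right flip: scaleC_of_real)
    ultimately show ?thesis
      by (simp cong: has_sum_cong)
  qed
  \<comment> \<open>The total mass is the derivative of the trace of \<open>\<rho>\<close>, which is
    constantly 1 on the domain.\<close>
  have \<nu>0: "\<nu> k UNIV = 0" for k
  proof -
    have "P UNIV = id" using qpm by (simp add: qpm_def)
    then have "\<nu> k UNIV = wirtinger k (\<lambda>\<beta>. Tr (\<rho> \<beta>)) \<alpha>"
      by (simp add: \<nu>_def interchange_trace[OF \<alpha>])
    also have "\<dots> = wirtinger k (\<lambda>_. 1) \<alpha>"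
      by (rule wirtinger_cong[OF _ domain(1) \<alpha>]) (simp_all add: Tr_eqI[OF pos(2)])
    finally show ?thesis by (simp add: wirtinger_const)
  qed
  \<comment> \<open>Unbiasedness identifies the mean with \<open>\<theta>\<close> on the whole
    domain, so their derivatives at \<open>\<alpha>\<close> agree.\<close>
  have D: "has_complex_measure_integral borel (\<nu> k) (\<lambda>x. x $ i) (?D $ i $ k)" for i k
  proof -
    have "(\<lambda>\<beta>. \<theta> \<beta> $ i) differentiable (at \<alpha>)"
      using theta_diff[OF \<alpha>] bounded_linear.has_derivative[OF bounded_linear_vec_nth]
      unfolding differentiable_def by blast
    then have "wirtinger k (\<lambda>\<beta>. \<integral>x. x $ i \<partial>outcome_distr borel P (\<rho> \<beta>)) \<alpha> = ?D $ i $ k"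
      unfolding wirtinger_matrix_def vec_lambda_beta
      by (rule wirtinger_cong[OF _ domain(1) \<alpha>])
        (simp add: has_bochner_integral_integral_eq[OF unbiased])
    then show ?thesis
      using interchange_mean[OF \<alpha>, of k i] by (simp add: \<nu>_def[abs_def])
  qed
  have \<mu>: "finite_measure ?\<mu>" "sets ?\<mu> = sets borel"
    "\<And>B. B \<in> sets borel \<Longrightarrow> ((\<lambda>e. p e * Re (cinner e (P B e))) has_sum measure ?\<mu> B) E"
    using outcome_distr_diagonal[OF qpm pos[OF \<alpha>] E diag p] by (simp_all add: sets_outcome_distr)
  have sq: "integrable ?\<mu> (\<lambda>x. (cmod (x $ i - ?t $ i))\<^sup>2)" for i
    using integrable_norm[OF covariance_finite[OF \<alpha>, of i i]]
    by (simp add: norm_mult power2_eq_square del: complex_cnj_diff)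
  show "matrix_ge (covariance_matrix ?\<mu> ?t) (?D ** matrix_inv ?H ** conj_transpose ?D)"
  proof (rule matrix_ge_of_bilinear_bound[OF covariance_matrix_hermitian H_herm nondegenerate[OF \<alpha>]
        covariance_quadratic_form[OF covariance_finite[OF \<alpha>]]])
    fix z :: "complex^'m" and c :: "complex^'n"
    show "(cmod (\<Sum>i\<in>UNIV. \<Sum>k\<in>UNIV. cnj (z $ i) * ?D $ i $ k * c $ k))\<^sup>2
      \<le> (\<integral>x. (cmod (\<Sum>i\<in>UNIV. cnj (z $ i) * (x $ i - ?t $ i)))\<^sup>2 \<partial>?\<mu>)
        * Re (\<Sum>k\<in>UNIV. \<Sum>l\<in>UNIV. cnj (c $ k) * ?H $ k $ l * c $ l)"
      by (rule cramer_rao_bilinear[OF qpm p \<mu> sq \<nu> \<nu>0 H D])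
  qed simp
qed

end
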